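(* Let $k$ be a field of characteristic $0$, let $R$ be a finite field extension of $k$, let $A=R[\mathcal S,\mathcal D;\sigma,\delta]$ be a differential difference algebra over $R$, and fix a DD-monomial ordering $>$ on the set $\mathcal M$ of standard monomials of $A$. Let $I$ be a left ideal of $A$ generated by nonzero elements $f_1,\dots,f_l\in A$. Then the Left Gröbner-Shirshov Basis Algorithm (described in the context), run with input $F=\{f_1,\dots,f_l\}$, terminates after finitely many steps and returns a finite left Gröbner-Shirshov basis for $I$ with respect to $>$.
   Context: All algebras are unital associative $k$-algebras; $\mathbb N$ includes $0$. A derivation on an algebra $R$ is a $k$-linear map $\delta$ with $\delta(ab)=a\delta(b)+\delta(a)b$. $R\langle a_1,\dots,a_s\rangle$ denotes the subalgebra generated by $R$ and $a_1,\dots,a_s$. Differential difference algebra: an algebra $A$ is a differential difference algebra of type $(m,n)$ ($m,n\in\mathbb N$) over a subalgebra $R\subseteq A$, written $A=R[\mathcal S,\mathcal D;\sigma,\delta]$, if there are elements $S_1,\dots,S_m,D_1,\dots,D_n\in A$ such that: (i) the elements $S_1^{\alpha_1}\cdots S_m^{\alpha_m}D_1^{\beta_1}\cdots D_n^{\beta_n}$ ($\alpha_i,\beta_j\in\mathbb N$) form a basis of $A$ as a free left $R$-module; (ii) $D_ir=rD_i+\delta_i(r)$ for $r\in R$, $1\le i\le n$, with $\delta_i$ a derivation on $R$; (iii) $S_ir=\sigma_i^{-1}(r)S_i$ (equivalently $rS_i=S_i\sigma_i(r)$) for $r\in R$, $1\le i\le m$, where $\sigma_i$ is a $k$-algebra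 automorphism of $R\langle D_1,\dots,D_n\rangle$ restricting to an automorphism of $R$ and with $\sigma_i(D_j)=\sum_{s=1}^n a_{ijs}D_s$, $a_{ijs}\in R$; (iv) $D_iS_j=S_j\sigma_j(D_i)$; (v) the $S_i$ commute with each other and the $D_j$ commute with each other; (vi) the $\delta_i$ commute with each other and the $\sigma_i$ commute with each other. These elements are fixed. $\mathcal S^\alpha\mathcal D^\beta=S_1^{\alpha_1}\cdots S_m^{\alpha_m}D_1^{\beta_1}\cdots D_n^{\beta_n}$, and $\mathcal M=\{\mathcal S^\alpha\mathcal D^\beta:\alpha\in\mathbb N^m,\beta\in\mathbb N^n\}$. For a total order on $\mathcal M$ and $0\ne f\in A$, $\operatorname{Supp}(f)$ is the set of monomials occurring in $f$ with nonzero coefficient (as a left $R$-combination of $\mathcal M$), $\operatorname{lm}(f)$ is the largest of them, $\operatorname{lc}(f)$ is its coefficient, $\operatorname{lt}(f)=\operatorname{lc}(f)\operatorname{lm}(f)$; $\operatorname{Supp}(0)=\emptyset$. A DD-monomial ordering is a (total) well-ordering $>$ on $\mathcal M$ such that $u>v$ implies $\operatorname{lm}(fu)>\operatorname{lm}(fv)$ for all $0\neq f\in A$. $f$ is right divisible by $g$ if $f=hg$ for some $h\in A$. A set $G\subseteq I$ (of nonzero elements) is a left Gröbner-Shirshov basis of $I$ if for every $0\ne f\in I$ there is $g\in G$ with $\operatorname{lm}(f)$ right divisible by $\operatorname{lm}(g)$. $\operatorname{Irr}(G)=\{w\in\mathcal M: w\ne f\operatorname{lm}(g)\text{ for all }g\in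 G,f\in A\}$. $\operatorname{lclm}(\mathcal S^\alpha\mathcal D^\beta,\mathcal S^{\alpha'}\mathcal D^{\beta'})=\mathcal S^\mu\mathcal D^\nu$ with $\mu_i=\max\{\alpha_i,\alpha_i'\}$, $\nu_j=\max\{\beta_j,\beta_j'\}$. For nonzero $f,g$ there are unique $f',g'\in A$ with $f'\operatorname{lt}(f)=\operatorname{lclm}(\operatorname{lm}(f),\operatorname{lm}(g))=g'\operatorname{lt}(g)$; then $\operatorname{Spoly}(f,g)=f'f-g'g$. Remainders: a one-step reduction of $f$ modulo $g$ replaces $f$ by $f-ag$, where $a\in A$ and $\operatorname{lt}(ag)$ equals one of the terms of $f$ (a nonzero coefficient times its monomial). A remainder of $f$ modulo $G$ is an element $r$ obtained from $f$ by a finite (possibly empty) chain of one-step reductions modulo elements of $G$, with $\operatorname{Supp}(r)\subseteq\operatorname{Irr}(G)$. Left Gröbner-Shirshov Basis Algorithm. Input: a finite set $F$ of nonzero elements of $A$. Initialize $G:=F$, $P:=\{\{p,q\}:p\ne q,\ p,q\in F\}$. While $P\ne\emptyset$: choose any pair $\{p,q\}\in P$ and remove it from $P$; let $r$ be a remainder of $\operatorname{Spoly}(p,q)$ modulo $G$; if $r\ne0$, replace $P$ by $P\cup\{\{g,r\}:g\in G\}$ and $G$ by $G\cup\{r\}$. When $P=\emptyset$, output $G$. *)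

theory Defs
  imports Complex_Main
begin

text \<open>The ring type \<open>'a\<close> is the ambient algebra and \<open>'k\<close> is the ground field; subalgebras,
  left ideals and so on are subsets of \<open>'a\<close>.\<close>

locale k_algebra = vector_space scale
  for scale :: "'k::field \<Rightarrow> 'a::ring_1 \<Rightarrow> 'a" (infixr "*s" 75) +
  assumes scale_mult_left: "c *s (x * y) = (c *s x) * y"
    and scale_mult_right: "c *s (x * y) = x * (c *s y)"
begin

definition subalgebra :: "'a set \<Rightarrow> bool" where
  "subalgebra B \<longleftrightarrow> subspace B \<and> 1 \<in> B \<and> (\<forall>x\<in>B. \<forall>y\<in>B. x * y \<in> B)"

definition generated_subalgebra :: "'a set \<Rightarrow> 'a set" where
  "generated_subalgebra X = subalgebra hull X"

definition derivation_on :: "'a set \<Rightarrow> ('a \<Rightarrow> 'a) \<Rightarrow> bool" where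
  "derivation_on B d \<longleftrightarrow>
     (\<forall>x\<in>B. d x \<in> B) \<and>
     (\<forall>x\<in>B. \<forall>y\<in>B. d (x + y) = d x + d y) \<and>
     (\<forall>c. \<forall>x\<in>B. d (c *s x) = c *s d x) \<and>
     (\<forall>x\<in>B. \<forall>y\<in>B. d (x * y) = x * d y + d x * y)"

definition automorphism_on :: "'a set \<Rightarrow> ('a \<Rightarrow> 'a) \<Rightarrow> bool" where
  "automorphism_on B h \<longleftrightarrow>
     bij_betw h B B \<and>
     (\<forall>x\<in>B. \<forall>y\<in>B. h (x + y) = h x + h y) \<and>
     (\<forall>c. \<forall>x\<in>B. h (c *s x) = c *s h x) \<and>
     (\<forall>x\<in>B. \<forall>y\<in>B. h (x * y) = h x * h y) \<and>
     h 1 = 1"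

text \<open>The ground field embeds into the subalgebra \<open>R\<close> by \<open>c \<mapsto> c *s 1\<close>, so a finite extension
  field of it inside \<open>'a\<close> is a subalgebra that is a field and has a finite spanning set.\<close>

definition finite_field_extension :: "'a set \<Rightarrow> bool" where
  "finite_field_extension R \<longleftrightarrow>
     subalgebra R \<and>
     (\<forall>x\<in>R. \<forall>y\<in>R. x * y = y * x) \<and>
     (\<forall>x\<in>R. x \<noteq> 0 \<longrightarrow> (\<exists>y\<in>R. x * y = 1)) \<and>
     (\<exists>B. finite B \<and> span B = R)"

end

definition left_ideal :: "'a::ring_1 set \<Rightarrow> bool" where
  "left_ideal I \<longleftrightarrow> 0 \<in> I \<and> (\<forall>x\<in>I. \<forall>y\<in>I. x + y \<in> I) \<and> (\<forall>a. \<forall>x\<in>I. a * x \<in> I)"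

definition generated_left_ideal :: "'a::ring_1 set \<Rightarrow> 'a set" where
  "generated_left_ideal X = left_ideal hull X"

text \<open>The family \<open>b\<close>, indexed by \<open>J\<close>, is a basis of \<open>'a\<close> as a left module over the subring \<open>R\<close>.
  Independence is that of the family, so it includes injectivity of \<open>b\<close> on \<open>J\<close>.\<close>

definition left_basis :: "'a::ring_1 set \<Rightarrow> 'i set \<Rightarrow> ('i \<Rightarrow> 'a) \<Rightarrow> bool" where
  "left_basis R J b \<longleftrightarrow>
     (\<forall>K c. finite K \<and> K \<subseteq> J \<and> (\<forall>i\<in>K. c i \<in> R) \<and> (\<Sum>i\<in>K. c i * b i) = 0
        \<longrightarrow> (\<forall>i\<in>K. c i = 0)) \<and>
     (\<forall>x. \<exists>K c. finite K \<and> K \<subseteq> J \<and> (\<forall>i\<in>K. c i \<in> R) \<and> x = (\<Sum>i\<in>K. c i * b i))"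


text \<open>Generators are numbered from \<open>0\<close>; an exponent vector of length \<open>n\<close> is a function on the
  naturals vanishing from \<open>n\<close> on.\<close>

definition exponents :: "nat \<Rightarrow> (nat \<Rightarrow> nat) set" where
  "exponents n = {\<alpha>. \<forall>i\<ge>n. \<alpha> i = 0}"

definition std_monomial ::
  "nat \<Rightarrow> nat \<Rightarrow> (nat \<Rightarrow> 'a::ring_1) \<Rightarrow> (nat \<Rightarrow> 'a) \<Rightarrow> (nat \<Rightarrow> nat) \<Rightarrow> (nat \<Rightarrow> nat) \<Rightarrow> 'a" where
  "std_monomial m n S D \<alpha> \<beta> =
     prod_list (map (\<lambda>i. S i ^ \<alpha> i) [0..<m]) * prod_list (map (\<lambda>j. D j ^ \<beta> j) [0..<n])"

locale dd_algebra = k_algebra scale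
  for scale :: "'k::field \<Rightarrow> 'a::ring_1 \<Rightarrow> 'a" (infixr "*s" 75) +
  fixes R :: "'a set" and m n :: nat
    and S D :: "nat \<Rightarrow> 'a"
    and \<sigma> \<delta> :: "nat \<Rightarrow> 'a \<Rightarrow> 'a"
  assumes subalgebra_R: "subalgebra R"
    and monomial_basis:
      "left_basis R (exponents m \<times> exponents n) (\<lambda>(\<alpha>, \<beta>). std_monomial m n S D \<alpha> \<beta>)"
    and derivation_\<delta>: "i < n \<Longrightarrow> derivation_on R (\<delta> i)"
    and D_coeff: "i < n \<Longrightarrow> r \<in> R \<Longrightarrow> D i * r = r * D i + \<delta> i r"
    and automorphism_\<sigma>:
      "i < m \<Longrightarrow> automorphism_on (generated_subalgebra (R \<union> D ` {..<n})) (\<sigma> i)"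
    and automorphism_\<sigma>_R: "i < m \<Longrightarrow> automorphism_on R (\<sigma> i)"
    and \<sigma>_D: "i < m \<Longrightarrow> j < n \<Longrightarrow> \<exists>a. (\<forall>s<n. a s \<in> R) \<and> \<sigma> i (D j) = (\<Sum>s<n. a s * D s)"
    and S_coeff: "i < m \<Longrightarrow> r \<in> R \<Longrightarrow> S i * r = inv_into R (\<sigma> i) r * S i"
    and D_S: "i < n \<Longrightarrow> j < m \<Longrightarrow> D i * S j = S j * \<sigma> j (D i)"
    and S_commute: "i < m \<Longrightarrow> j < m \<Longrightarrow> S i * S j = S j * S i"
    and D_commute: "i < n \<Longrightarrow> j < n \<Longrightarrow> D i * D j = D j * D i"
    and \<delta>_commute: "i < n \<Longrightarrow> j < n \<Longrightarrow> r \<in> R \<Longrightarrow> \<delta> i (\<delta> j r) = \<delta> j (\<delta> i r)"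
    and \<sigma>_commute:
      "i < m \<Longrightarrow> j < m \<Longrightarrow> x \<in> generated_subalgebra (R \<union> D ` {..<n}) \<Longrightarrow>
         \<sigma> i (\<sigma> j x) = \<sigma> j (\<sigma> i x)"
begin

definition monomials :: "'a set" where
  "monomials = {std_monomial m n S D \<alpha> \<beta> | \<alpha> \<beta>. \<alpha> \<in> exponents m \<and> \<beta> \<in> exponents n}"

definition coeffs :: "'a \<Rightarrow> 'a \<Rightarrow> 'a" where
  "coeffs f = (THE c. (\<forall>w\<in>monomials. c w \<in> R) \<and> (\<forall>w. w \<notin> monomials \<longrightarrow> c w = 0) \<and>
                      finite {w. c w \<noteq> 0} \<and> f = (\<Sum>w | c w \<noteq> 0. c w * w))"

definition Supp :: "'a \<Rightarrow> 'a set" where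
  "Supp f = {w \<in> monomials. coeffs f w \<noteq> 0}"

definition right_divisible :: "'a \<Rightarrow> 'a \<Rightarrow> bool" where
  "right_divisible f g \<longleftrightarrow> (\<exists>h. f = h * g)"

definition lclm :: "'a \<Rightarrow> 'a \<Rightarrow> 'a" where
  "lclm u v = (THE w. \<exists>\<alpha>\<in>exponents m. \<exists>\<beta>\<in>exponents n. \<exists>\<alpha>'\<in>exponents m. \<exists>\<beta>'\<in>exponents n.
     u = std_monomial m n S D \<alpha> \<beta> \<and> v = std_monomial m n S D \<alpha>' \<beta>' \<and>
     w = std_monomial m n S D (\<lambda>i. max (\<alpha> i) (\<alpha>' i)) (\<lambda>j. max (\<beta> j) (\<beta>' j)))"

end


locale dd_algebra_order = dd_algebra scale R m n S D \<sigma> \<delta>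
  for scale :: "'k::field \<Rightarrow> 'a::ring_1 \<Rightarrow> 'a" (infixr "*s" 75)
    and R :: "'a set" and m n :: nat
    and S D :: "nat \<Rightarrow> 'a"
    and \<sigma> \<delta> :: "nat \<Rightarrow> 'a \<Rightarrow> 'a" +
  fixes gt :: "'a \<Rightarrow> 'a \<Rightarrow> bool" (infix "\<succ>" 50)
begin

text \<open>The leading monomial is meaningful for nonzero arguments only.\<close>

definition lm :: "'a \<Rightarrow> 'a" where
  "lm f = (THE w. w \<in> Supp f \<and> (\<forall>v\<in>Supp f. v \<noteq> w \<longrightarrow> w \<succ> v))"

definition lc :: "'a \<Rightarrow> 'a" where
  "lc f = coeffs f (lm f)"

definition lt :: "'a \<Rightarrow> 'a" where
  "lt f = lc f * lm f"

definition dd_monomial_ordering :: bool where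
  "dd_monomial_ordering \<longleftrightarrow>
     irreflp_on monomials (\<succ>) \<and> transp_on monomials (\<succ>) \<and> totalp_on monomials (\<succ>) \<and>
     wfp_on monomials (\<lambda>u v. v \<succ> u) \<and>
     (\<forall>u\<in>monomials. \<forall>v\<in>monomials. \<forall>f. f \<noteq> 0 \<and> u \<succ> v \<longrightarrow> lm (f * u) \<succ> lm (f * v))"

definition left_GS_basis :: "'a set \<Rightarrow> 'a set \<Rightarrow> bool" where
  "left_GS_basis I G \<longleftrightarrow>
     G \<subseteq> I \<and> 0 \<notin> G \<and> (\<forall>f\<in>I. f \<noteq> 0 \<longrightarrow> (\<exists>g\<in>G. right_divisible (lm f) (lm g)))"

definition Irr :: "'a set \<Rightarrow> 'a set" where
  "Irr G = {w \<in> monomials. \<forall>g\<in>G. \<forall>f. w \<noteq> f * lm g}"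

definition Spoly :: "'a \<Rightarrow> 'a \<Rightarrow> 'a" where
  "Spoly f g =
     (THE f'. f' * lt f = lclm (lm f) (lm g)) * f - (THE g'. g' * lt g = lclm (lm f) (lm g)) * g"

definition reduces_by :: "'a \<Rightarrow> 'a \<Rightarrow> 'a \<Rightarrow> bool" where
  "reduces_by g f f' \<longleftrightarrow>
     (\<exists>a. a * g \<noteq> 0 \<and> (\<exists>w\<in>Supp f. lt (a * g) = coeffs f w * w) \<and> f' = f - a * g)"

definition remainder :: "'a set \<Rightarrow> 'a \<Rightarrow> 'a \<Rightarrow> bool" where
  "remainder G f r \<longleftrightarrow> (\<lambda>x y. \<exists>g\<in>G. reduces_by g x y)\<^sup>*\<^sup>* f r \<and> Supp r \<subseteq> Irr G"

text \<open>A state of the algorithm is the current pair \<open>(G, P)\<close>. The algorithm is nondeterministic: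
  the pair, its orientation (which only changes the sign of the S-polynomial) and the remainder
  are chosen freely.\<close>

definition gs_init :: "'a set \<Rightarrow> 'a set \<times> 'a set set" where
  "gs_init F = (F, {{p, q} | p q. p \<in> F \<and> q \<in> F \<and> p \<noteq> q})"

inductive gs_step :: "'a set \<times> 'a set set \<Rightarrow> 'a set \<times> 'a set set \<Rightarrow> bool" where
  zero: "{p, q} \<in> P \<Longrightarrow> remainder G (Spoly p q) 0 \<Longrightarrow> gs_step (G, P) (G, P - {{p, q}})"
| nonzero: "{p, q} \<in> P \<Longrightarrow> remainder G (Spoly p q) r \<Longrightarrow> r \<noteq> 0 \<Longrightarrow>
    gs_step (G, P) (G \<union> {r}, (P - {{p, q}}) \<union> {{g, r} | g. g \<in> G})"

end

end

theory Submission
  imports Defs "HOL-Library.Infinite_Set"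
begin

text \<open>Write \<open>B\<close> for the algebra generated by \<open>R\<close> and the \<open>D\<^sub>j\<close>. A finite extension of a field of characteristic
\<open>0\<close> has no nonzero derivations (\<open>derivation_zero_on_finite_extension\<close>). Hence the \<open>D\<^sub>j\<close> commute with
\<open>R\<close>, and \<open>B\<close> is a commutative polynomial ring over the field \<open>R\<close>. The \<open>S\<^sub>i\<close> satisfy \<open>S\<^sub>i B = B S\<^sub>i\<close>
and \<open>S\<^sub>i R = R S\<^sub>i\<close>, because \<open>\<sigma>\<^sub>i\<close> is bijective on \<open>B\<close> and on \<open>R\<close>. Three consequences make the monomials of
\<open>A\<close> behave like those of a polynomial ring, although a product of two monomials may have many terms:

\<^item> right divisibility of monomials is the componentwise order of exponents
  (\<open>right_divisible_iff_exp_dvd\<close>, \<open>exp_dvd_std\<close>), so \<open>lclm\<close> is a least common multiple and Dickson's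
  lemma applies;

\<^item> multiplication by a monomial on the right is injective (\<open>times_monomial_eq_zero_iff\<close>);

\<^item> a nonzero scalar between two factors, the second a monomial, does not change the support of the product
  (\<open>times_scaled_monomial\<close>).

A DD-monomial ordering only compares \<open>h u\<close> with \<open>h v\<close> for monomials \<open>u\<close> and \<open>v\<close>. With the last two facts
this gives \<open>lm (h f) = lm (h lm f)\<close> (\<open>lm_mult\<close>), and this monomial is right divisible by \<open>lm f\<close>. There is
no control over \<open>lm h\<close>, so the usual proof of Buchberger's criterion, which replaces each cofactor \<open>h\<close>
by its leading term, is not available. Instead the cofactors are kept whole and sorted by \<open>lm (h g)\<close>.

Let \<open>G\<close> be such that every S-polynomial \<open>Spoly p q\<close> is a sum of products \<open>h g\<close> with \<open>g \<in> G\<close> and \<open>lm (h g)\<close>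
smaller than \<open>lclm (lm p) (lm q)\<close>. Let \<open>f = \<Sum> h g\<close> with all \<open>lm (h g)\<close> at most \<open>t\<close>. If \<open>b lt q = t\<close> for
some \<open>q \<in> G\<close>, then each summand with leading monomial \<open>t\<close> is an \<open>R\<close>-multiple of \<open>b q\<close>, up to products
\<open>h g\<close> with leading monomials below \<open>t\<close>: two ways to reach \<open>t\<close> differ by a left multiple of an S-polynomial
(\<open>cofactor_multiples_differ_by_lower\<close>). So \<open>f = c b q + \<dots>\<close> (\<open>combinations_upto_split\<close>). If \<open>c \<noteq> 0\<close>, then
\<open>lm f = t\<close>, which is divisible by \<open>lm q\<close>; if \<open>c = 0\<close>, then \<open>f\<close> has a representation with a smaller bound, and
well-founded induction finishes the proof (\<open>buchberger_criterion\<close>).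

For the algorithm, a reduction that removes the greatest reducible monomial only creates smaller ones,
so remainders exist (\<open>ex_remainder\<close>). The algorithm preserves the property that every pair in \<open>G\<close> is still
pending or has a resolved S-polynomial (\<open>gs_invariant\<close>), so the criterion holds once no pair is left. A new
element of \<open>G\<close> has a leading monomial that is not divisible by any earlier one. By Dickson's lemma this
happens finitely often, and the remaining steps use up the finite set of pairs (\<open>gs_terminates\<close>).\<close>

section \<open>Ordered products of powers and normalizing elements\<close>

definition power_product :: "(nat \<Rightarrow> 'a::monoid_mult) \<Rightarrow> nat \<Rightarrow> (nat \<Rightarrow> nat) \<Rightarrow> 'a" where
  "power_product X n \<alpha> = prod_list (map (\<lambda>i. X i ^ \<alpha> i) [0..<n])"

lemma power_product_0 [simp]: "power_product X 0 \<alpha> = 1"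
  by (simp add: power_product_def)

lemma power_product_Suc [simp]:
  "power_product X (Suc n) \<alpha> = power_product X n \<alpha> * X n ^ \<alpha> n"
  by (simp add: power_product_def)

lemma power_product_zero_exponent: "power_product X n (\<lambda>i. 0) = 1"
  by (induction n) auto

lemma power_product_unit_exponent:
  "j < n \<Longrightarrow> power_product X n (\<lambda>i. if i = j then 1 else 0) = X j"
proof (induction n)
  case (Suc n)
  have "power_product X k (\<lambda>i. if i = j then 1 else 0) = 1" if "k \<le> j" for k
    using that by (induction k) auto
  with Suc show ?case by (cases "j = n") auto
qed simp

lemma commutes_with_power_product:
  assumes "\<And>i. i < n \<Longrightarrow> y * X i = X i * y"
  shows "y * power_product X n \<alpha> = power_product X n \<alpha> * y"
  using assms
proof (induction n)
  case (Suc n)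
  have "y * X n ^ \<alpha> n = X n ^ \<alpha> n * y"
    using Suc.prems[of n] power_commuting_commutes by (metis lessI)
  moreover have "y * power_product X n \<alpha> = power_product X n \<alpha> * y"
    using Suc by auto
  ultimately show ?case by (simp add: mult.assoc flip: mult.assoc[of y])
qed simp

lemma power_product_add:
  assumes "\<And>i j. i < n \<Longrightarrow> j < n \<Longrightarrow> X i * X j = X j * X i"
  shows "power_product X n (\<lambda>i. \<alpha> i + \<beta> i) = power_product X n \<alpha> * power_product X n \<beta>"
  using assms
proof (induction n)
  case (Suc n)
  have "X n ^ \<alpha> n * X i = X i * X n ^ \<alpha> n" if "i < n" for i
    using Suc.prems[of n i] that by (intro power_commuting_commutes) auto
  then have comm: "X n ^ \<alpha> n * power_product X n \<beta> = power_product X n \<beta> * X n ^ \<alpha> n"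
    by (rule commutes_with_power_product)
  have "power_product X n (\<lambda>i. \<alpha> i + \<beta> i) = power_product X n \<alpha> * power_product X n \<beta>"
    using Suc by auto
  moreover have "power_product X n \<alpha> * (X n ^ \<alpha> n * power_product X n \<beta>) * X n ^ \<beta> n
      = power_product X n \<alpha> * (power_product X n \<beta> * X n ^ \<alpha> n) * X n ^ \<beta> n"
    by (simp only: comm)
  ultimately show ?case by (simp add: power_add mult.assoc)
qed simp

text \<open>The condition \<open>u X = X u\<close>: elements of \<open>X\<close> can be moved across \<open>u\<close> in both directions, at the price of
changing them.\<close>
definition normalizes :: "'a::monoid_mult set \<Rightarrow> 'a \<Rightarrow> bool" where
  "normalizes X u \<longleftrightarrow> (\<lambda>x. u * x) ` X = (\<lambda>x. x * u) ` X"

lemma normalizes_left: "normalizes X u \<Longrightarrow> x \<in> X \<Longrightarrow> \<exists>y\<in>X. u * x = y * u"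
  unfolding normalizes_def by blast

lemma normalizes_right: "normalizes X u \<Longrightarrow> x \<in> X \<Longrightarrow> \<exists>y\<in>X. x * u = u * y"
  unfolding normalizes_def by blast

lemma normalizesI:
  assumes "\<And>x. x \<in> X \<Longrightarrow> \<exists>y\<in>X. u * x = y * u" "\<And>x. x \<in> X \<Longrightarrow> \<exists>y\<in>X. x * u = u * y"
  shows "normalizes X u"
  using assms unfolding normalizes_def by (auto simp: image_iff)

lemma normalizes_mult:
  assumes "normalizes X u" "normalizes X v"
  shows "normalizes X (u * v)"
proof (rule normalizesI)
  fix x assume "x \<in> X"
  then obtain y where y: "y \<in> X" "v * x = y * v" using normalizes_left[OF assms(2)] by blast
  then obtain z where z: "z \<in> X" "u * y = z * u" using normalizes_left[OF assms(1)] by blast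
  have "u * v * x = u * y * v" by (simp add: y mult.assoc)
  then show "\<exists>y\<in>X. u * v * x = y * (u * v)" using z by (auto simp: mult.assoc)
next
  fix x assume "x \<in> X"
  then obtain y where y: "y \<in> X" "x * u = u * y" using normalizes_right[OF assms(1)] by blast
  then obtain z where z: "z \<in> X" "y * v = v * z" using normalizes_right[OF assms(2)] by blast
  have "x * (u * v) = u * (y * v)" by (simp add: y flip: mult.assoc)
  then show "\<exists>y\<in>X. x * (u * v) = u * v * y" using z by (auto simp: mult.assoc)
qed

lemma normalizes_1: "normalizes X 1"
  by (simp add: normalizes_def)

lemma normalizes_power: "normalizes X u \<Longrightarrow> normalizes X (u ^ k)"
  by (induction k) (auto intro: normalizes_1 normalizes_mult)

lemma normalizes_power_product:
  "(\<And>i. i < n \<Longrightarrow> normalizes X (Y i)) \<Longrightarrow> normalizes X (power_product Y n \<alpha>)"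
  by (induction n) (auto intro: normalizes_1 normalizes_mult normalizes_power)

section \<open>Derivations of finite extensions in characteristic zero\<close>

context k_algebra
begin

lemma subalgebra_closed:
  assumes "subalgebra B"
  shows "0 \<in> B" "1 \<in> B" "x \<in> B \<Longrightarrow> y \<in> B \<Longrightarrow> x + y \<in> B" "x \<in> B \<Longrightarrow> y \<in> B \<Longrightarrow> x - y \<in> B"
    "x \<in> B \<Longrightarrow> - x \<in> B" "x \<in> B \<Longrightarrow> y \<in> B \<Longrightarrow> x * y \<in> B" "x \<in> B \<Longrightarrow> c *s x \<in> B"
    "x \<in> B \<Longrightarrow> x ^ i \<in> B"
proof -
  show *: "0 \<in> B" "1 \<in> B" "x \<in> B \<Longrightarrow> y \<in> B \<Longrightarrow> x + y \<in> B" "x \<in> B \<Longrightarrow> y \<in> B \<Longrightarrow> x - y \<in> B"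
    "x \<in> B \<Longrightarrow> - x \<in> B" "x \<in> B \<Longrightarrow> y \<in> B \<Longrightarrow> x * y \<in> B" "x \<in> B \<Longrightarrow> c *s x \<in> B" for x y
    using assms by (auto simp: subalgebra_def subspace_0 subspace_add subspace_diff subspace_neg
        subspace_scale)
  show "x \<in> B \<Longrightarrow> x ^ i \<in> B" by (induction i) (auto intro: *)
qed

lemma derivation_power:
  assumes B: "subalgebra B" and comm: "\<And>x y. x \<in> B \<Longrightarrow> y \<in> B \<Longrightarrow> x * y = y * x"
    and d: "derivation_on B d" and x: "x \<in> B"
  shows "d (x ^ i) = (of_nat i *s x ^ (i - 1)) * d x"
proof (induction i)
  case 0
  have "d (1 * 1) = 1 * d 1 + d 1 * 1"
    using d subalgebra_closed(2)[OF B] unfolding derivation_on_def by blast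
  then show ?case by simp
next
  case (Suc i)
  have dx: "d x \<in> B" using d x by (auto simp: derivation_on_def)
  have "d (x * x ^ i) = x * d (x ^ i) + d x * x ^ i"
    using d x subalgebra_closed(8)[OF B x] unfolding derivation_on_def by blast
  also have "\<dots> = (of_nat i *s (x * x ^ (i - 1))) * d x + x ^ i * d x"
    using comm[OF dx subalgebra_closed(8)[OF B x]]
    by (simp add: Suc scale_mult_right mult.assoc flip: scale_mult_left)
  also have "of_nat i *s (x * x ^ (i - 1)) = of_nat i *s x ^ i"
    by (cases i) auto
  also have "(of_nat i *s x ^ i) * d x + x ^ i * d x = (of_nat (Suc i) *s x ^ i) * d x"
    by (simp add: distrib_right scale_left_distrib)
  finally show ?case by simp
qed

text \<open>Otherwise the powers of \<open>x\<close> would be linearly independent, which is impossible inside the span of a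
finite set.\<close>
lemma power_in_span_of_smaller:
  assumes B: "finite B" and x: "\<And>i. x ^ i \<in> span B"
  shows "\<exists>i. x ^ i \<in> span ((\<lambda>j. x ^ j) ` {..<i})"
proof (rule ccontr)
  assume "\<not> ?thesis"
  then have not_in: "x ^ i \<notin> span ((\<lambda>j. x ^ j) ` {..<i})" for i by blast
  let ?P = "\<lambda>i. (\<lambda>j. x ^ j) ` {..<i}"
  have *: "independent (?P i) \<and> card (?P i) = i" for i
  proof (induction i)
    case (Suc i)
    have "x ^ i \<notin> ?P i"
      using not_in[of i] span_base[of "x ^ i" "?P i"] by blast
    moreover have "?P (Suc i) = insert (x ^ i) (?P i)" by (simp add: lessThan_Suc)
    ultimately show ?case
      using not_in[of i] Suc by (simp only: independent_insert) (simp del: image_eqI)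
  qed (simp add: independent_empty)
  have "?P i \<subseteq> span B" for i using x by auto
  then have "i \<le> card B" for i
    using independent_span_bound[OF B, of "?P i"] *[of i] by simp
  from this[of "Suc (card B)"] show False by simp
qed

text \<open>This is the usual argument with the minimal polynomial, written with spans. Let \<open>i\<close> be minimal such that
\<open>x\<^sup>i\<close> is a combination of smaller powers. Applying \<open>d\<close> to this relation gives
\<open>(i x\<^sup>i\<^sup>-\<^sup>1 - z) d x = 0\<close> with \<open>z\<close> in the span of the powers below \<open>i - 1\<close>. If \<open>d x\<close> were nonzero it could be
cancelled, and \<open>x\<^sup>i\<^sup>-\<^sup>1\<close> would contradict the minimality of \<open>i\<close>.\<close>
lemma derivation_zero_on_finite_extension:
  assumes char0: "\<And>i. i > 0 \<Longrightarrow> of_nat i \<noteq> (0 :: 'k)"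
    and K: "finite_field_extension K" and d: "derivation_on K d" and x: "x \<in> K"
  shows "d x = 0"
proof (rule ccontr)
  assume dx: "d x \<noteq> 0"
  let ?P = "\<lambda>i. (\<lambda>j. x ^ j) ` {..<i}"
  have sub: "subalgebra K" and comm: "\<And>x y. x \<in> K \<Longrightarrow> y \<in> K \<Longrightarrow> x * y = y * x"
    and inv: "\<And>x. x \<in> K \<Longrightarrow> x \<noteq> 0 \<Longrightarrow> \<exists>y\<in>K. x * y = 1"
    using K by (auto simp: finite_field_extension_def)
  note closed = subalgebra_closed[OF sub]
  have dxK: "d x \<in> K" using d x by (auto simp: derivation_on_def)
  obtain B where B: "finite B" "span B = K"
    using K by (auto simp: finite_field_extension_def)
  have "\<exists>i. x ^ i \<in> span (?P i)"
    using power_in_span_of_smaller[OF B(1)] B(2) closed(8)[OF x] by blast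
  then obtain i where i: "x ^ i \<in> span (?P i)" and least: "\<And>j. j < i \<Longrightarrow> x ^ j \<notin> span (?P j)"
    using exists_least_iff[of "\<lambda>i. x ^ i \<in> span (?P i)"] by auto
  have "i > 0" using i by (cases i) auto
  have span_K: "span (?P j) \<subseteq> K" for j
    using closed(8)[OF x] sub by (intro span_minimal) (auto simp: subalgebra_def)
  \<comment> \<open>Differentiation lowers the degree in \<open>x\<close> by one and produces a factor \<open>d x\<close>.\<close>
  have "y \<in> K \<and> (\<exists>z\<in>span (?P (i - 1)). d y = z * d x)" if "y \<in> span (?P i)" for y
    using that
  proof (induction rule: span_induct_alt)
    case base
    have "d (0 *s 1) = 0 *s d 1" using d closed(2) unfolding derivation_on_def by blast
    then show ?case by (auto intro!: bexI[of _ 0] closed(1) simp: span_zero)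
  next
    case (step c y z)
    then obtain j where j: "j < i" "y = x ^ j" by auto
    obtain z' where z': "z' \<in> span (?P (i - 1))" "d z = z' * d x" using step by auto
    have dy: "d y = (of_nat j *s x ^ (j - 1)) * d x"
      unfolding j by (rule derivation_power[OF sub comm d x])
    have yz: "y \<in> K" "z \<in> K"
      using j closed(8)[OF x] step by auto
    then have "d (c *s y + z) = c *s d y + d z"
      using d closed(7)[of y c] by (auto simp: derivation_on_def)
    then have "d (c *s y + z) = (c *s (of_nat j *s x ^ (j - 1)) + z') * d x"
      using dy z' by (simp add: distrib_right scale_mult_left)
    moreover have "of_nat j *s x ^ (j - 1) \<in> span (?P (i - 1))"
      using j by (cases j) (auto intro!: span_scale[OF span_base] simp: span_zero)
    moreover have "c *s y + z \<in> K" using closed(3,7) yz by auto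
    ultimately show ?case using z' by (blast intro: span_add[OF span_scale])
  qed
  from this[OF i] obtain z where z: "z \<in> span (?P (i - 1))" "d (x ^ i) = z * d x"
    by blast
  then have "(of_nat i *s x ^ (i - 1) - z) * d x = 0"
    using derivation_power[OF sub comm d x, of i] by (simp add: algebra_simps)
  then have "(of_nat i *s x ^ (i - 1) - z) * d x * e = 0" for e by simp
  moreover obtain e where "d x * e = 1" using inv[OF dxK dx] by blast
  ultimately have "of_nat i *s x ^ (i - 1) - z = 0"
    by (metis mult.assoc mult.right_neutral)
  then have "x ^ (i - 1) = inverse (of_nat i) *s z"
    using char0[OF \<open>i > 0\<close>] by (metis eq_iff_diff_eq_0 left_inverse scale_one scale_scale)
  then have "x ^ (i - 1) \<in> span (?P (i - 1))"
    using span_scale[OF z(1)] by metis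
  then show False using least[of "i - 1"] \<open>i > 0\<close> by simp
qed

end

section \<open>Coefficients and supports\<close>

context dd_algebra
begin

lemmas R_closed = subalgebra_closed[OF subalgebra_R]

abbreviation std :: "(nat \<Rightarrow> nat) \<Rightarrow> (nat \<Rightarrow> nat) \<Rightarrow> 'a" where
  "std \<equiv> std_monomial m n S D"

lemma std_eq: "std \<alpha> \<beta> = power_product S m \<alpha> * power_product D n \<beta>"
  by (simp add: std_monomial_def power_product_def)

lemma std_in_monomials: "\<alpha> \<in> exponents m \<Longrightarrow> \<beta> \<in> exponents n \<Longrightarrow> std \<alpha> \<beta> \<in> monomials"
  by (auto simp: monomials_def)

lemma basis_independent:
  assumes "finite K" "K \<subseteq> exponents m \<times> exponents n" "\<And>i. i \<in> K \<Longrightarrow> c i \<in> R"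
    "(\<Sum>i\<in>K. c i * (case i of (\<alpha>, \<beta>) \<Rightarrow> std \<alpha> \<beta>)) = 0" "i \<in> K"
  shows "c i = 0"
  using monomial_basis[unfolded left_basis_def, THEN conjunct1, rule_format, of K c i] assms by simp

lemma std_inj_on: "inj_on (\<lambda>(\<alpha>, \<beta>). std \<alpha> \<beta>) (exponents m \<times> exponents n)"
  (is "inj_on ?b ?J")
proof (rule inj_onI)
  fix x y assume xy: "x \<in> ?J" "y \<in> ?J" "?b x = ?b y"
  show "x = y"
  proof (rule ccontr)
    assume ne: "x \<noteq> y"
    let ?c = "\<lambda>i. if i = x then 1 else - 1 :: 'a"
    have "(\<Sum>i\<in>{x, y}. ?c i * ?b i) = 0" using ne xy(3) by simp
    moreover have "finite {x, y} \<and> {x, y} \<subseteq> ?J \<and> (\<forall>i\<in>{x, y}. ?c i \<in> R)"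
      using xy R_closed(2,5) by auto
    ultimately have "?c x = 0"
      using basis_independent[of "{x, y}" ?c x] by blast
    then show False by simp
  qed
qed

lemma std_inject:
  assumes "\<alpha> \<in> exponents m" "\<beta> \<in> exponents n" "\<alpha>' \<in> exponents m" "\<beta>' \<in> exponents n"
  shows "std \<alpha> \<beta> = std \<alpha>' \<beta>' \<longleftrightarrow> \<alpha> = \<alpha>' \<and> \<beta> = \<beta>'"
  using inj_onD[OF std_inj_on, of "(\<alpha>, \<beta>)" "(\<alpha>', \<beta>')"] assms by auto

lemma monomials_image: "monomials = (\<lambda>(\<alpha>, \<beta>). std \<alpha> \<beta>) ` (exponents m \<times> exponents n)"
  by (force simp: monomials_def)

lemma monomials_independent:
  assumes K: "finite K" "K \<subseteq> monomials" "\<And>w. w \<in> K \<Longrightarrow> c w \<in> R" "(\<Sum>w\<in>K. c w * w) = 0"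
    and w: "w \<in> K"
  shows "c w = 0"
proof -
  let ?b = "\<lambda>(\<alpha>, \<beta>). std \<alpha> \<beta>"
  obtain L where L: "L \<subseteq> exponents m \<times> exponents n" "K = ?b ` L"
    using K(2) unfolding monomials_image by (meson subset_imageE)
  have inj: "inj_on ?b L" using std_inj_on L(1) by (rule inj_on_subset)
  have "finite L" using K(1) L(2) inj finite_image_iff by blast
  moreover have "(\<Sum>i\<in>L. c (?b i) * ?b i) = 0"
    using K(4) unfolding L(2) sum.reindex[OF inj] by (simp add: o_def case_prod_beta)
  moreover have "c (?b i) \<in> R" if "i \<in> L" for i using K(3) L(2) that by blast
  ultimately have "c (?b i) = 0" if "i \<in> L" for i
    using basis_independent[OF _ L(1), of "\<lambda>i. c (?b i)" i] that by blast
  then show ?thesis using w L(2) by auto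
qed

lemma monomials_spanning:
  "\<exists>K c. finite K \<and> K \<subseteq> monomials \<and> (\<forall>w\<in>K. c w \<in> R) \<and> x = (\<Sum>w\<in>K. c w * w)"
proof -
  let ?b = "\<lambda>(\<alpha>, \<beta>). std \<alpha> \<beta>"
  obtain L c where L: "finite L" "L \<subseteq> exponents m \<times> exponents n" "\<forall>i\<in>L. c i \<in> R"
    "x = (\<Sum>i\<in>L. c i * ?b i)"
    using monomial_basis[unfolded left_basis_def] by meson
  have inj: "inj_on ?b L" using std_inj_on L(2) by (rule inj_on_subset)
  let ?c = "\<lambda>w. c (inv_into L ?b w)"
  have "x = (\<Sum>w\<in>?b ` L. ?c w * w)"
    using inj unfolding L(4) sum.reindex[OF inj]
    by (intro sum.cong) (auto simp: inv_into_f_f[OF inj])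
  moreover have "\<forall>w\<in>?b ` L. ?c w \<in> R"
    using L(3) inj by (auto simp: inv_into_f_f)
  ultimately show ?thesis
    using L(1,2) unfolding monomials_image
    by (intro exI[of _ "?b ` L"] exI[of _ ?c] conjI image_mono finite_imageI) simp_all
qed

text \<open>Any representation by monomials satisfies the definite description that defines \<open>coeffs\<close>, and by
independence of the monomials there is only one.\<close>
lemma coeffs_eqI:
  assumes K: "finite K" "K \<subseteq> monomials" "\<And>w. w \<in> K \<Longrightarrow> c w \<in> R" "x = (\<Sum>w\<in>K. c w * w)"
  shows "coeffs x = (\<lambda>w. if w \<in> K then c w else 0)"
  unfolding coeffs_def
proof (rule the_equality)
  let ?e = "\<lambda>w. if w \<in> K then c w else 0"
  have fin: "finite {w. ?e w \<noteq> 0}"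
    by (rule finite_subset[OF _ K(1)]) auto
  have "x = (\<Sum>w | ?e w \<noteq> 0. ?e w * w)"
    unfolding K(4) using K(1) by (intro sum.mono_neutral_cong_right) auto
  with fin show "(\<forall>w\<in>monomials. ?e w \<in> R) \<and> (\<forall>w. w \<notin> monomials \<longrightarrow> ?e w = 0) \<and>
      finite {w. ?e w \<noteq> 0} \<and> x = (\<Sum>w | ?e w \<noteq> 0. ?e w * w)"
    using K(2,3) R_closed(1) by auto
  fix d assume d: "(\<forall>w\<in>monomials. d w \<in> R) \<and> (\<forall>w. w \<notin> monomials \<longrightarrow> d w = 0) \<and>
      finite {w. d w \<noteq> 0} \<and> x = (\<Sum>w | d w \<noteq> 0. d w * w)"
  then have d_R: "w \<in> monomials \<Longrightarrow> d w \<in> R" and d_sub: "d w \<noteq> 0 \<Longrightarrow> w \<in> monomials"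
    and d_fin: "finite {w. d w \<noteq> 0}" and d_sum: "(\<Sum>w | d w \<noteq> 0. d w * w) = x" for w
    by blast+
  let ?L = "K \<union> {w. d w \<noteq> 0}"
  have fin: "finite ?L" using K(1) d_fin by simp
  have sub: "?L \<subseteq> monomials" using K(2) d_sub by blast
  have "(\<Sum>w\<in>?L. ?e w * w) = (\<Sum>w\<in>K. c w * w)"
    using fin by (intro sum.mono_neutral_cong_right) auto
  moreover have "(\<Sum>w\<in>?L. d w * w) = (\<Sum>w | d w \<noteq> 0. d w * w)"
    using fin by (intro sum.mono_neutral_right) auto
  ultimately have "(\<Sum>w\<in>?L. (d w - ?e w) * w) = 0"
    unfolding left_diff_distrib sum_subtractf d_sum using K(4) by simp
  moreover have "d w - ?e w \<in> R" if "w \<in> ?L" for w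
  proof -
    have "?e w \<in> R" using K(3) R_closed(1) by simp
    then show ?thesis using d_R sub that by (blast intro: R_closed(4))
  qed
  ultimately have eq: "d w - ?e w = 0" if "w \<in> ?L" for w
    using monomials_independent[OF fin sub, of "\<lambda>w. d w - ?e w" w] that by blast
  show "d = ?e"
  proof
    fix w show "d w = ?e w" using eq[of w] by (cases "w \<in> ?L") simp_all
  qed
qed

lemma
  shows coeffs_in_R: "coeffs x w \<in> R" and finite_Supp: "finite (Supp x)"
    and coeffs_outside: "w \<notin> Supp x \<Longrightarrow> coeffs x w = 0"
    and expansion: "x = (\<Sum>w\<in>Supp x. coeffs x w * w)"
proof -
  obtain K c where K: "finite K" "K \<subseteq> monomials" "\<forall>w\<in>K. c w \<in> R"
    "x = (\<Sum>w\<in>K. c w * w)"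
    using monomials_spanning[of x] by (elim exE conjE) (rule that)
  have c: "coeffs x = (\<lambda>w. if w \<in> K then c w else 0)"
    using K(3) by (intro coeffs_eqI[OF K(1,2) _ K(4)]) blast
  show "coeffs x w \<in> R" using K(3) R_closed(1) by (auto simp: c)
  have supp: "Supp x = {w \<in> K. c w \<noteq> 0}" using K(2) by (auto simp: Supp_def c)
  then show "finite (Supp x)" using K(1) by simp
  show "w \<notin> Supp x \<Longrightarrow> coeffs x w = 0" by (auto simp: supp c)
  have "(\<Sum>w\<in>K. c w * w) = (\<Sum>w\<in>Supp x. coeffs x w * w)"
    unfolding supp c using K(1) by (intro sum.mono_neutral_cong_right) auto
  then show "x = (\<Sum>w\<in>Supp x. coeffs x w * w)" using K(4) by simp
qed

lemma Supp_subset_monomials: "Supp x \<subseteq> monomials"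
  by (auto simp: Supp_def)

lemma in_Supp_iff: "w \<in> Supp x \<longleftrightarrow> coeffs x w \<noteq> 0"
  using coeffs_outside by (auto simp: Supp_def)

lemma coeffs_add: "coeffs (x + y) w = coeffs x w + coeffs y w"
proof -
  let ?K = "Supp x \<union> Supp y"
  have eq: "z = (\<Sum>w\<in>?K. coeffs z w * w)" if "Supp z \<subseteq> ?K" for z
  proof -
    have "(\<Sum>w\<in>Supp z. coeffs z w * w) = (\<Sum>w\<in>?K. coeffs z w * w)"
      using that by (intro sum.mono_neutral_left) (auto simp: finite_Supp coeffs_outside)
    then show ?thesis by (rule trans[OF expansion[of z]])
  qed
  have "x + y = (\<Sum>w\<in>?K. (coeffs x w + coeffs y w) * w)"
    using eq[of x] eq[of y] by (simp add: distrib_right sum.distrib)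
  then have "coeffs (x + y) = (\<lambda>w. if w \<in> ?K then coeffs x w + coeffs y w else 0)"
    using Supp_subset_monomials by (intro coeffs_eqI) (auto simp: finite_Supp coeffs_in_R R_closed(3))
  then show ?thesis by (auto simp: coeffs_outside)
qed

lemma coeffs_scale: "r \<in> R \<Longrightarrow> coeffs (r * x) w = r * coeffs x w"
proof -
  assume r: "r \<in> R"
  have "r * x = (\<Sum>w\<in>Supp x. (r * coeffs x w) * w)"
    using arg_cong[OF expansion[of x], of "(*) r"] by (simp add: sum_distrib_left mult.assoc)
  then have "coeffs (r * x) = (\<lambda>w. if w \<in> Supp x then r * coeffs x w else 0)"
    using Supp_subset_monomials r
    by (intro coeffs_eqI) (auto simp: finite_Supp coeffs_in_R R_closed(6))
  then show ?thesis by (auto simp: coeffs_outside)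
qed

lemma coeffs_zero [simp]: "coeffs 0 w = 0"
  using coeffs_scale[of 0 0 w] R_closed(1) by simp

lemma coeffs_uminus: "coeffs (- x) w = - coeffs x w"
  using coeffs_scale[of "- 1" x w] R_closed(2,5) by simp

lemma coeffs_diff: "coeffs (x - y) w = coeffs x w - coeffs y w"
  using coeffs_add[of x "- y" w] by (simp add: coeffs_uminus)

lemma coeffs_monomial: "w \<in> monomials \<Longrightarrow> coeffs w v = (if v = w then 1 else 0)"
  using coeffs_eqI[of "{w}" "\<lambda>_. 1" w] R_closed(2) by auto

lemma Supp_zero [simp]: "Supp 0 = {}"
  by (auto simp: in_Supp_iff)

lemma Supp_empty_iff: "Supp x = {} \<longleftrightarrow> x = 0"
proof (rule iffI)
  assume "Supp x = {}"
  then have "(\<Sum>w\<in>Supp x. coeffs x w * w) = 0" by simp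
  then show "x = 0" by (rule trans[OF expansion[of x]])
qed simp

lemma Supp_monomial: "w \<in> monomials \<Longrightarrow> Supp w = {w}"
  by (auto simp: in_Supp_iff coeffs_monomial split: if_splits)

lemma monomial_nonzero: "w \<in> monomials \<Longrightarrow> w \<noteq> 0"
  using Supp_monomial[of w] by auto

lemma Supp_add: "Supp (x + y) \<subseteq> Supp x \<union> Supp y"
  by (auto simp: in_Supp_iff coeffs_add)

lemma Supp_add_subset: "Supp x \<subseteq> X \<Longrightarrow> Supp y \<subseteq> X \<Longrightarrow> Supp (x + y) \<subseteq> X"
  using Supp_add by blast

lemma Supp_diff: "Supp (x - y) \<subseteq> Supp x \<union> Supp y"
  by (auto simp: in_Supp_iff coeffs_diff)

lemma Supp_uminus [simp]: "Supp (- x) = Supp x"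
  by (auto simp: in_Supp_iff coeffs_uminus)

lemma Supp_scale_subset: "r \<in> R \<Longrightarrow> Supp (r * x) \<subseteq> Supp x"
  by (auto simp: in_Supp_iff coeffs_scale)

lemma Supp_scaled_monomial: "r \<in> R \<Longrightarrow> w \<in> monomials \<Longrightarrow> w \<in> X \<Longrightarrow> Supp (r * w) \<subseteq> X"
  using Supp_scale_subset[of r w] by (simp add: Supp_monomial) blast

text \<open>Additive statements about \<open>x\<close> need to be checked on scalar multiples of the monomials of \<open>x\<close> only.\<close>
lemma Supp_induct [consumes 1, case_names zero add monomial]:
  assumes "Supp x \<subseteq> X"
    and zero: "P 0" and add: "\<And>x y. P x \<Longrightarrow> P y \<Longrightarrow> P (x + y)"
    and monomial: "\<And>r w. r \<in> R \<Longrightarrow> w \<in> monomials \<Longrightarrow> w \<in> X \<Longrightarrow> P (r * w)"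
  shows "P x"
proof -
  have "P (\<Sum>w\<in>K. coeffs x w * w)" if "finite K" "K \<subseteq> Supp x" for K
    using that
  proof (induction K rule: finite_induct)
    case (insert w K)
    from insert.prems have w: "w \<in> Supp x" by simp
    then have "w \<in> X" using assms(1) by blast
    moreover have "w \<in> monomials" using w by (simp add: Supp_def)
    ultimately have "P (coeffs x w * w)" by (intro monomial coeffs_in_R)
    then show ?case using insert by (simp add: add)
  qed (simp add: zero)
  from this[OF finite_Supp order_refl] show ?thesis
    by (simp only: expansion[of x, symmetric])
qed

end

section \<open>Coefficients in a field that commute with the derivation variables\<close>

text \<open>The situation that remains over a field \<open>R\<close> when the derivations \<open>\<delta>\<^sub>i\<close> vanish.\<close>
locale dd_algebra_field = dd_algebra scale R m n S D \<sigma> \<delta>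
  for scale :: "'k::field \<Rightarrow> 'a::ring_1 \<Rightarrow> 'a" (infixr "*s" 75)
    and R :: "'a set" and m n :: nat
    and S D :: "nat \<Rightarrow> 'a"
    and \<sigma> \<delta> :: "nat \<Rightarrow> 'a \<Rightarrow> 'a" +
  assumes R_commute: "x \<in> R \<Longrightarrow> y \<in> R \<Longrightarrow> x * y = y * x"
    and R_inverse: "x \<in> R \<Longrightarrow> x \<noteq> 0 \<Longrightarrow> \<exists>y\<in>R. x * y = 1"
    and D_R: "i < n \<Longrightarrow> r \<in> R \<Longrightarrow> D i * r = r * D i"
begin

lemma R_unit:
  assumes "x \<in> R" "x \<noteq> 0" obtains y where "y \<in> R" "y \<noteq> 0" "x * y = 1" "y * x = 1"
  using R_inverse[OF assms] R_commute[OF assms(1)] by (metis mult_zero_right zero_neq_one)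

lemma R_no_zero_divisor: "x \<in> R \<Longrightarrow> x \<noteq> 0 \<Longrightarrow> x * y = 0 \<longleftrightarrow> y = 0"
  by (metis R_unit mult.assoc mult.left_neutral mult_zero_right)

lemma R_no_zero_divisor_right: "x \<in> R \<Longrightarrow> x \<noteq> 0 \<Longrightarrow> y * x = 0 \<longleftrightarrow> y = 0"
  by (metis R_unit mult.assoc mult.right_neutral mult_zero_left)

definition Dalg :: "'a set" where
  "Dalg = generated_subalgebra (R \<union> D ` {..<n})"

text \<open>The standard monomials whose \<open>S\<close>-part is trivial. They span \<open>Dalg\<close> (\<open>Supp_Dalg\<close>).\<close>
definition Dmonomials :: "'a set" where
  "Dmonomials = power_product D n ` exponents n"

lemma exponents_zero: "(\<lambda>i. 0) \<in> exponents k"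
  by (simp add: exponents_def)

lemma exponents_add: "\<alpha> \<in> exponents k \<Longrightarrow> \<beta> \<in> exponents k \<Longrightarrow> (\<lambda>i. \<alpha> i + \<beta> i) \<in> exponents k"
  by (simp add: exponents_def)

lemma exponents_unit: "j < k \<Longrightarrow> (\<lambda>i. if i = j then 1 else 0) \<in> exponents k"
  by (simp add: exponents_def)

lemma Dpower_add: "power_product D n (\<lambda>i. \<alpha> i + \<beta> i) = power_product D n \<alpha> * power_product D n \<beta>"
  by (rule power_product_add) (rule D_commute)

lemma Spower_add: "power_product S m (\<lambda>i. \<alpha> i + \<beta> i) = power_product S m \<alpha> * power_product S m \<beta>"
  by (rule power_product_add) (rule S_commute)

lemma Dpower_R: "r \<in> R \<Longrightarrow> power_product D n \<beta> * r = r * power_product D n \<beta>"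
  by (rule commutes_with_power_product[symmetric]) (simp add: D_R)

lemma Dmonomials_subset: "Dmonomials \<subseteq> monomials"
  unfolding Dmonomials_def
  using std_in_monomials[OF exponents_zero] by (auto simp: std_eq power_product_zero_exponent)

lemma one_in_Dmonomials: "1 \<in> Dmonomials"
  using imageI[OF exponents_zero, of "power_product D n"]
  by (simp add: Dmonomials_def power_product_zero_exponent)

lemma one_in_monomials: "1 \<in> monomials"
  using one_in_Dmonomials Dmonomials_subset by auto

lemma Dmonomials_mult: "v \<in> Dmonomials \<Longrightarrow> w \<in> Dmonomials \<Longrightarrow> v * w \<in> Dmonomials"
  unfolding Dmonomials_def by (auto simp: image_iff) (metis Dpower_add exponents_add)

lemma scale_one_in_R: "c *s 1 \<in> R"
  using R_closed(2,7) by auto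

lemma scale_eq: "c *s x = (c *s 1) * x"
  by (simp flip: scale_mult_left)

lemma subalgebra_Supp_Dmonomials: "subalgebra {x. Supp x \<subseteq> Dmonomials}"
proof -
  have "Supp (x * y) \<subseteq> Dmonomials" if x: "Supp x \<subseteq> Dmonomials" and y: "Supp y \<subseteq> Dmonomials" for x y
    using x
  proof (induction rule: Supp_induct)
    case (monomial r v)
    note v = this
    show ?case
      using y
    proof (induction rule: Supp_induct)
      case (monomial s w)
      have vw: "v * w \<in> Dmonomials" using v(3) monomial(3) by (rule Dmonomials_mult)
      have "v * s = s * v" using v(3) monomial(1) by (auto simp: Dmonomials_def Dpower_R)
      then have "(r * v) * (s * w) = (r * s) * (v * w)"
        by (metis mult.assoc)
      moreover have "Supp ((r * s) * (v * w)) \<subseteq> Dmonomials"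
        using v(1) monomial(1) vw Dmonomials_subset
        by (intro Supp_scaled_monomial) (auto simp: R_closed(6))
      ultimately show ?case by simp
    qed (simp_all add: distrib_left Supp_add_subset)
  qed (simp_all add: distrib_right Supp_add_subset)
  moreover have "subspace {x. Supp x \<subseteq> Dmonomials}"
  proof (rule subspaceI)
    fix c x assume "x \<in> {x. Supp x \<subseteq> Dmonomials}"
    then show "c *s x \<in> {x. Supp x \<subseteq> Dmonomials}"
      using Supp_scale_subset[OF scale_one_in_R, of c x] by (subst scale_eq) auto
  qed (auto intro: subsetD[OF Supp_add_subset])
  ultimately show ?thesis
    using Supp_monomial[OF one_in_monomials] one_in_Dmonomials by (auto simp: subalgebra_def)
qed

lemma subalgebra_Dalg: "subalgebra Dalg"
  unfolding Dalg_def generated_subalgebra_def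
proof (rule hull_in)
  fix T assume "Ball T subalgebra"
  then show "subalgebra (\<Inter>T)"
    using subspace_Inter by (auto simp: subalgebra_def)
qed

lemma R_subset_Dalg: "R \<subseteq> Dalg" and D_in_Dalg: "i < n \<Longrightarrow> D i \<in> Dalg"
  using hull_subset[of "R \<union> D ` {..<n}" subalgebra]
  by (auto simp: Dalg_def generated_subalgebra_def)

lemma Dalg_minimal: "subalgebra B \<Longrightarrow> R \<subseteq> B \<Longrightarrow> D ` {..<n} \<subseteq> B \<Longrightarrow> Dalg \<subseteq> B"
  unfolding Dalg_def generated_subalgebra_def by (simp add: hull_minimal)

lemma Dpower_in_Dalg: "power_product D k \<beta> \<in> Dalg" if "k \<le> n"
  using that
  by (induction k) (auto intro!: subalgebra_closed(2,6,8)[OF subalgebra_Dalg] D_in_Dalg)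

lemma Supp_Dalg: "x \<in> Dalg \<Longrightarrow> Supp x \<subseteq> Dmonomials"
proof -
  have "R \<subseteq> {x. Supp x \<subseteq> Dmonomials}"
    using Supp_scale_subset[of _ 1] Supp_monomial[OF one_in_monomials] one_in_Dmonomials by auto
  moreover have "D i \<in> Dmonomials" if "i < n" for i
    using power_product_unit_exponent[of i n D] exponents_unit[of i n] that
    by (metis Dmonomials_def imageI)
  then have "Supp (D i) \<subseteq> Dmonomials" if "i < n" for i
    using Supp_scaled_monomial[OF R_closed(2), of "D i"] Dmonomials_subset that by auto
  then have "D ` {..<n} \<subseteq> {x. Supp x \<subseteq> Dmonomials}" by auto
  ultimately show "x \<in> Dalg \<Longrightarrow> Supp x \<subseteq> Dmonomials"
    using Dalg_minimal[OF subalgebra_Supp_Dmonomials] by auto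
qed

lemma automorphism_\<sigma>_Dalg: "j < m \<Longrightarrow> automorphism_on Dalg (\<sigma> j)"
  using automorphism_\<sigma> by (simp add: Dalg_def)

lemma \<sigma>_S_R: assumes j: "j < m" and r: "r \<in> R" shows "r * S j = S j * \<sigma> j r"
proof -
  have "inj_on (\<sigma> j) R" "\<sigma> j r \<in> R"
    using automorphism_\<sigma>_R[OF j] r by (auto simp: automorphism_on_def bij_betw_def)
  then show ?thesis using S_coeff[OF j, of "\<sigma> j r"] r by simp
qed

text \<open>The rules for moving \<open>R\<close> and the \<open>D\<^sub>i\<close> across \<open>S\<^sub>j\<close> extend to \<open>Dalg\<close>, because the elements that obey
the rule form a subalgebra.\<close>
lemma \<sigma>_S: "r * S j = S j * \<sigma> j r" if j: "j < m" and r: "r \<in> Dalg"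
proof -
  have aut: "automorphism_on Dalg (\<sigma> j)" using j by (rule automorphism_\<sigma>_Dalg)
  let ?B = "{x \<in> Dalg. x * S j = S j * \<sigma> j x}"
  note closed = subalgebra_closed[OF subalgebra_Dalg]
  have sc: "\<sigma> j (c *s x) = c *s \<sigma> j x" if "x \<in> Dalg" for c x
    using aut that by (auto simp: automorphism_on_def)
  have "\<sigma> j (0 *s 1) = 0 *s \<sigma> j 1"
    using sc closed(2) by blast
  then have "subspace ?B"
    using aut
    by (intro subspaceI) (auto simp: closed sc automorphism_on_def distrib_left distrib_right
        simp flip: scale_mult_left scale_mult_right)
  moreover have "x * y * S j = S j * \<sigma> j (x * y)" if "x \<in> ?B" "y \<in> ?B" for x y
  proof -
    have "x * y * S j = x * (S j * \<sigma> j y)" using that by (simp add: mult.assoc)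
    also have "\<dots> = S j * (\<sigma> j x * \<sigma> j y)" using that by (simp flip: mult.assoc)
    finally show ?thesis using aut that by (simp add: automorphism_on_def)
  qed
  ultimately have "subalgebra ?B"
    using aut closed by (auto simp: subalgebra_def automorphism_on_def)
  then have "Dalg \<subseteq> ?B"
    using R_subset_Dalg D_in_Dalg j by (intro Dalg_minimal) (auto simp: \<sigma>_S_R D_S)
  then show ?thesis using r by auto
qed

lemma S_normalizes:
  assumes j: "j < m" shows "normalizes R (S j)" "normalizes Dalg (S j)"
proof -
  have *: "normalizes B (S j)"
    if aut: "automorphism_on B (\<sigma> j)" and eq: "\<And>x. x \<in> B \<Longrightarrow> x * S j = S j * \<sigma> j x" for B
  proof (rule normalizesI)
    fix x assume "x \<in> B"
    moreover have "\<sigma> j ` B = B" using aut by (simp add: automorphism_on_def bij_betw_def)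
    ultimately have "x \<in> \<sigma> j ` B" by simp
    then obtain y where "y \<in> B" "\<sigma> j y = x" by blast
    then show "\<exists>y\<in>B. S j * x = y * S j" using eq[of y] by (intro bexI[of _ y]) simp_all
  next
    fix x assume "x \<in> B"
    moreover from this have "\<sigma> j x \<in> B"
      using aut by (auto simp: automorphism_on_def bij_betw_def)
    ultimately show "\<exists>y\<in>B. x * S j = S j * y" using eq[of x] by (intro bexI[of _ "\<sigma> j x"])
  qed
  show "normalizes R (S j)"
    by (rule *[OF automorphism_\<sigma>_R[OF j] \<sigma>_S_R[OF j]])
  show "normalizes Dalg (S j)"
    by (rule *[OF automorphism_\<sigma>_Dalg[OF j] \<sigma>_S[OF j]])
qed

lemma Spower_normalizes:
  "normalizes R (power_product S m \<alpha>)" "normalizes Dalg (power_product S m \<alpha>)"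
  by (auto intro!: normalizes_power_product S_normalizes)

lemma Dpower_normalizes: "normalizes R (power_product D n \<beta>)"
  using Dpower_R by (fastforce intro: normalizesI)

lemma monomial_normalizes: "w \<in> monomials \<Longrightarrow> normalizes R w"
  by (auto simp: monomials_def std_eq intro!: normalizes_mult Spower_normalizes Dpower_normalizes)

lemma monomial_times_R:
  assumes "w \<in> monomials" "r \<in> R" "r \<noteq> 0"
  obtains s where "s \<in> R" "s \<noteq> 0" "w * r = s * w"
proof -
  obtain s where s: "s \<in> R" "w * r = s * w"
    using normalizes_left[OF monomial_normalizes] assms by blast
  moreover have "s \<noteq> 0"
    using s(2) assms monomial_nonzero[OF assms(1)] by (auto simp: R_no_zero_divisor_right)
  ultimately show ?thesis using that by blast
qed

lemma R_times_monomial: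
  assumes "w \<in> monomials" "r \<in> R" "r \<noteq> 0"
  obtains s where "s \<in> R" "s \<noteq> 0" "r * w = w * s"
proof -
  obtain s where s: "s \<in> R" "r * w = w * s"
    using normalizes_right[OF monomial_normalizes] assms by blast
  moreover have "s \<noteq> 0"
    using s(2) assms monomial_nonzero[OF assms(1)] by (auto simp: R_no_zero_divisor)
  ultimately show ?thesis using that by blast
qed

lemma Supp_scale: "r \<in> R \<Longrightarrow> r \<noteq> 0 \<Longrightarrow> Supp (r * x) = Supp x"
  by (auto simp: in_Supp_iff coeffs_scale R_no_zero_divisor coeffs_in_R)

text \<open>Moving \<open>r\<close> to the left of a monomial turns it into another nonzero scalar, which depends on the monomial.
So the coefficients of \<open>x\<close> change, but none of them becomes zero.\<close>
lemma Supp_times_R: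
  assumes r: "r \<in> R" "r \<noteq> 0" shows "Supp (x * r) = Supp x"
proof -
  have "\<exists>s. s \<in> R \<and> s \<noteq> 0 \<and> w * r = s * w" if "w \<in> monomials" for w
    using monomial_times_R[OF that r] by metis
  then obtain t where t: "\<And>w. w \<in> monomials \<Longrightarrow> t w \<in> R \<and> t w \<noteq> 0 \<and> w * r = t w * w"
    by metis
  have "w * r = t w * w" if "w \<in> Supp x" for w
    using t that Supp_subset_monomials by blast
  then have "(\<Sum>w\<in>Supp x. coeffs x w * w) * r = (\<Sum>w\<in>Supp x. (coeffs x w * t w) * w)"
    by (simp add: sum_distrib_right mult.assoc)
  then have "x * r = (\<Sum>w\<in>Supp x. (coeffs x w * t w) * w)"
    by (simp only: expansion[of x, symmetric])
  moreover have "coeffs x w * t w \<in> R" if "w \<in> Supp x" for w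
    using that t Supp_subset_monomials coeffs_in_R R_closed(6) by blast
  ultimately have "coeffs (x * r) = (\<lambda>w. if w \<in> Supp x then coeffs x w * t w else 0)"
    using Supp_subset_monomials finite_Supp by (intro coeffs_eqI) auto
  then show ?thesis
    using t Supp_subset_monomials by (auto simp: in_Supp_iff R_no_zero_divisor_right subset_iff)
qed

section \<open>Right divisibility of monomials\<close>

text \<open>\<open>u\<close> and \<open>w\<close> are monomials, and the exponents of \<open>u\<close> are at most those of \<open>w\<close>; the difference is spelled
out, so that truncated subtraction is avoided.\<close>
definition exp_dvd :: "'a \<Rightarrow> 'a \<Rightarrow> bool" where
  "exp_dvd u w \<longleftrightarrow> (\<exists>\<alpha>\<in>exponents m. \<exists>\<beta>\<in>exponents n. \<exists>\<gamma>\<in>exponents m. \<exists>\<kappa>\<in>exponents n.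
     u = std \<alpha> \<beta> \<and> w = std (\<lambda>i. \<gamma> i + \<alpha> i) (\<lambda>i. \<kappa> i + \<beta> i))"

text \<open>Let \<open>u = S\<^sup>\<alpha> D\<^sup>\<beta>\<close>. Then \<open>S\<^sup>\<gamma> D\<^sup>\<kappa> u = S\<^sup>\<gamma> S\<^sup>\<alpha> y D\<^sup>\<beta>\<close> for some \<open>y\<close> in the commutative algebra \<open>Dalg\<close>, because \<open>S\<^sup>\<alpha>\<close>
normalizes it. So each monomial of the product has \<open>S\<close>-exponent \<open>\<gamma> + \<alpha>\<close> and its \<open>D\<close>-part is a multiple of
\<open>D\<^sup>\<beta>\<close>.\<close>
lemma Supp_times_monomial:
  assumes u: "u \<in> monomials" and w: "w \<in> Supp (x * u)"
  shows "exp_dvd u w"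
proof -
  obtain \<alpha> \<beta> where ab: "\<alpha> \<in> exponents m" "\<beta> \<in> exponents n" "u = std \<alpha> \<beta>"
    using u by (auto simp: monomials_def)
  let ?Q = "\<lambda>y. Supp y \<subseteq> Collect (exp_dvd u)"
  have "?Q (x * u)"
  proof (rule Supp_induct[where X = UNIV and x = x])
    fix r v assume v: "r \<in> R" "v \<in> monomials" "v \<in> UNIV"
    then obtain \<gamma> \<kappa> where gk: "\<gamma> \<in> exponents m" "\<kappa> \<in> exponents n" "v = std \<gamma> \<kappa>"
      by (auto simp: monomials_def)
    obtain y where y: "y \<in> Dalg" "power_product D n \<kappa> * power_product S m \<alpha> = power_product S m \<alpha> * y"
      using normalizes_right[OF Spower_normalizes(2) Dpower_in_Dalg] by blast
    have "?Q (power_product S m \<gamma> * power_product S m \<alpha> * z * power_product D n \<beta>)"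
      if "Supp z \<subseteq> Dmonomials" for z
      using that
    proof (induction rule: Supp_induct)
      case (monomial s d)
      obtain \<nu> where nu: "\<nu> \<in> exponents n" "d = power_product D n \<nu>"
        using monomial by (auto simp: Dmonomials_def)
      obtain s' where s': "s' \<in> R" "power_product S m (\<lambda>i. \<gamma> i + \<alpha> i) * s = s' * power_product S m (\<lambda>i. \<gamma> i + \<alpha> i)"
        using normalizes_left[OF Spower_normalizes(1)] monomial by blast
      have "power_product S m \<gamma> * power_product S m \<alpha> * (s * d) * power_product D n \<beta>
          = (power_product S m (\<lambda>i. \<gamma> i + \<alpha> i) * s) * power_product D n (\<lambda>i. \<nu> i + \<beta> i)"
        by (simp add: Spower_add Dpower_add nu mult.assoc)
      also have "\<dots> = s' * std (\<lambda>i. \<gamma> i + \<alpha> i) (\<lambda>i. \<nu> i + \<beta> i)"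
        unfolding s' by (simp add: std_eq mult.assoc)
      finally have "Supp (power_product S m \<gamma> * power_product S m \<alpha> * (s * d) * power_product D n \<beta>)
          \<subseteq> {std (\<lambda>i. \<gamma> i + \<alpha> i) (\<lambda>i. \<nu> i + \<beta> i)}"
        using Supp_scale_subset[OF s'(1)] Supp_monomial[OF std_in_monomials]
        by (metis exponents_add ab(1,2) gk(1) nu(1))
      moreover have "exp_dvd u (std (\<lambda>i. \<gamma> i + \<alpha> i) (\<lambda>i. \<nu> i + \<beta> i))"
        unfolding exp_dvd_def using ab gk(1) nu(1) by blast
      ultimately show ?case by blast
    qed (simp_all add: distrib_left distrib_right Supp_add_subset)
    from this[OF Supp_Dalg[OF y(1)]]
    have "?Q (v * u)"
      by (simp add: ab gk std_eq mult.assoc) (metis y(2) mult.assoc)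
    then show "?Q (r * v * u)"
      using Supp_scale_subset[OF v(1), of "v * u"] by (auto simp: mult.assoc)
  qed (simp_all add: distrib_right Supp_add_subset)
  then show ?thesis using w by auto
qed

text \<open>The quotient is in general not a monomial: \<open>D\<^sup>\<kappa>\<close> has to be moved across \<open>S\<^sup>\<alpha>\<close> from right to left, and this
replaces it by another element of \<open>Dalg\<close>.\<close>
lemma exp_dvd_imp_right_divisible:
  assumes "exp_dvd u w" shows "right_divisible w u"
proof -
  obtain \<alpha> \<beta> \<gamma> \<kappa> where *: "u = std \<alpha> \<beta>" "w = std (\<lambda>i. \<gamma> i + \<alpha> i) (\<lambda>i. \<kappa> i + \<beta> i)"
    using assms by (auto simp: exp_dvd_def)
  obtain y where y: "power_product S m \<alpha> * power_product D n \<kappa> = y * power_product S m \<alpha>"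
    using normalizes_left[OF Spower_normalizes(2) Dpower_in_Dalg] by blast
  have "w = (power_product S m \<gamma> * y) * u"
    by (simp add: * std_eq Spower_add Dpower_add mult.assoc) (metis y mult.assoc)
  then show ?thesis by (auto simp: right_divisible_def)
qed

lemma right_divisible_iff_exp_dvd:
  assumes "u \<in> monomials" "w \<in> monomials"
  shows "right_divisible w u \<longleftrightarrow> exp_dvd u w"
  using exp_dvd_imp_right_divisible Supp_times_monomial[OF assms(1), of w] Supp_monomial[OF assms(2)]
  by (auto simp: right_divisible_def)

section \<open>Right multiplication by a monomial is injective\<close>

definition right_regular :: "'a \<Rightarrow> bool" where
  "right_regular u \<longleftrightarrow> (\<forall>x. x * u = 0 \<longrightarrow> x = 0)"

definition linear_extension :: "('a \<Rightarrow> 'a) \<Rightarrow> 'a \<Rightarrow> 'a" where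
  "linear_extension q x = (\<Sum>w\<in>Supp x. coeffs x w * q w)"

lemma linear_extension_superset:
  assumes "finite K" "Supp x \<subseteq> K"
  shows "linear_extension q x = (\<Sum>w\<in>K. coeffs x w * q w)"
  unfolding linear_extension_def using assms
  by (intro sum.mono_neutral_left) (auto simp: coeffs_outside)

lemma linear_extension_add:
  "linear_extension q (x + y) = linear_extension q x + linear_extension q y"
  using linear_extension_superset[of "Supp x \<union> Supp y" _ q] Supp_add[of x y]
  by (simp add: finite_Supp coeffs_add distrib_right sum.distrib)

lemma linear_extension_scale: "r \<in> R \<Longrightarrow> linear_extension q (r * x) = r * linear_extension q x"
  using linear_extension_superset[of "Supp x" _ q] Supp_scale_subset[of r x]
  by (simp add: finite_Supp coeffs_scale sum_distrib_left mult.assoc)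

lemma linear_extension_zero: "linear_extension q 0 = 0"
  by (simp add: linear_extension_def)

lemma linear_extension_monomial: "w \<in> monomials \<Longrightarrow> linear_extension q w = q w"
  by (simp add: linear_extension_def Supp_monomial coeffs_monomial)

text \<open>The \<open>R\<close>-linear extension of \<open>q\<close> is a left inverse of right multiplication by \<open>u\<close>, as it is one on
monomials.\<close>
lemma right_regularI:
  assumes q: "\<And>w. w \<in> monomials \<Longrightarrow> linear_extension q (w * u) = w"
  shows "right_regular u"
proof -
  have "linear_extension q (x * u) = x" for x
  proof (rule Supp_induct[where X = UNIV and x = x])
    fix r w assume "r \<in> R" "w \<in> monomials"
    then show "linear_extension q (r * w * u) = r * w"
      using q by (simp add: mult.assoc linear_extension_scale)
  qed (simp_all add: linear_extension_zero linear_extension_add distrib_right)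
  then show ?thesis unfolding right_regular_def by (metis linear_extension_zero)
qed

lemma std_times_D:
  assumes "j < n" shows "std \<alpha> \<beta> * D j = std \<alpha> (\<lambda>i. \<beta> i + (if i = j then 1 else 0))"
  using power_product_unit_exponent[OF assms, of D] by (simp add: std_eq Dpower_add mult.assoc)

lemma right_regular_D:
  assumes j: "j < n" shows "right_regular (D j)"
proof (rule right_regularI)
  let ?f = "\<lambda>w. w * D j"
  have closed: "?f w \<in> monomials" if "w \<in> monomials" for w
    using that std_in_monomials exponents_add exponents_unit[OF j]
    by (auto simp: monomials_def std_times_D[OF j])
  have inj: "inj_on ?f monomials"
  proof (rule inj_onI)
    fix v w assume vw: "v \<in> monomials" "w \<in> monomials" "v * D j = w * D j"
    obtain \<alpha> \<beta> where v: "\<alpha> \<in> exponents m" "\<beta> \<in> exponents n" "v = std \<alpha> \<beta>"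
      using vw(1) by (auto simp: monomials_def)
    obtain \<gamma> \<kappa> where w: "\<gamma> \<in> exponents m" "\<kappa> \<in> exponents n" "w = std \<gamma> \<kappa>"
      using vw(2) by (auto simp: monomials_def)
    have *: "\<alpha> = \<gamma> \<and> (\<lambda>i. \<beta> i + (if i = j then 1 else 0)) = (\<lambda>i. \<kappa> i + (if i = j then 1 else 0))"
      using vw(3) std_inject[OF v(1) exponents_add[OF v(2) exponents_unit[OF j]]
          w(1) exponents_add[OF w(2) exponents_unit[OF j]]]
      by (simp add: v w std_times_D[OF j])
    then have "\<beta> i + (if i = j then 1 else 0) = \<kappa> i + (if i = j then 1 else 0)" for i by meson
    then have "\<beta> = \<kappa>" by auto
    with * show "v = w" by (simp add: v w)
  qed
  fix w assume w: "w \<in> monomials"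
  show "linear_extension (inv_into monomials ?f) (w * D j) = w"
    using linear_extension_monomial[OF closed[OF w]] inv_into_f_f[OF inj w] by simp
qed

text \<open>A left inverse is prescribed by sending \<open>S\<^sup>\<gamma> S\<^sub>j D\<^sup>\<kappa>\<close> to \<open>S\<^sup>\<gamma> \<sigma>\<^sub>j\<^sup>-\<^sup>1(D\<^sup>\<kappa>)\<close>. By linearity it sends \<open>S\<^sup>\<gamma> S\<^sub>j y\<close> to \<open>S\<^sup>\<gamma> \<sigma>\<^sub>j\<^sup>-\<^sup>1(y)\<close> for all \<open>y\<close> in \<open>Dalg\<close>, and
\<open>S\<^sup>\<gamma> D\<^sup>\<kappa> S\<^sub>j = S\<^sup>\<gamma> S\<^sub>j \<sigma>\<^sub>j(D\<^sup>\<kappa>)\<close> is of this form.\<close>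
lemma right_regular_S:
  assumes j: "j < m" shows "right_regular (S j)"
proof (rule right_regularI)
  let ?e = "\<lambda>i. if i = j then 1 else 0 :: nat"
  let ?S = "power_product S m" and ?D = "power_product D n"
  \<comment> \<open>The inverse of \<open>\<sigma>\<^sub>j\<close>; additivity is inherited from \<open>\<sigma>\<^sub>j\<close> (\<open>s_add\<close> below).\<close>
  let ?s = "inv_into Dalg (\<sigma> j)"
  let ?J = "exponents m \<times> exponents n"
  let ?f = "\<lambda>(\<gamma>, \<kappa>). std (\<lambda>i. \<gamma> i + ?e i) \<kappa>"
  let ?q = "\<lambda>v. case inv_into ?J ?f v of (\<gamma>, \<kappa>) \<Rightarrow> ?S \<gamma> * ?s (?D \<kappa>)"
  have aut: "automorphism_on Dalg (\<sigma> j)" using j by (rule automorphism_\<sigma>_Dalg)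
  then have bij: "bij_betw (\<sigma> j) Dalg Dalg" by (simp add: automorphism_on_def)
  have inj: "inj_on ?f ?J"
    using exponents_unit[OF j] exponents_add
    by (auto intro!: inj_onI simp: std_inject fun_eq_iff)
  have fS: "std (\<lambda>i. \<gamma> i + ?e i) \<kappa> = ?S \<gamma> * S j * ?D \<kappa>" for \<gamma> \<kappa>
    using power_product_unit_exponent[OF j, of S] by (simp add: std_eq Spower_add)
  have s_\<sigma>: "?s (\<sigma> j x) = x" if "x \<in> Dalg" for x
    using bij that by (simp add: bij_betw_def)
  have ex: "\<exists>x\<in>Dalg. y = \<sigma> j x" if "y \<in> Dalg" for y
    using bij that by (metis bij_betw_imp_surj_on imageE)
  note closed = subalgebra_closed[OF subalgebra_Dalg]
  have s_add: "?s (x + y) = ?s x + ?s y" if xy: "x \<in> Dalg" "y \<in> Dalg" for x y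
  proof -
    obtain a b where ab: "a \<in> Dalg" "x = \<sigma> j a" "b \<in> Dalg" "y = \<sigma> j b"
      using ex xy by meson
    have "x + y = \<sigma> j (a + b)" using aut ab by (simp add: automorphism_on_def)
    then show ?thesis using ab closed(3) by (simp add: s_\<sigma>)
  qed
  have q: "linear_extension ?q (?S \<gamma> * S j * y) = ?S \<gamma> * ?s y"
    if \<gamma>: "\<gamma> \<in> exponents m" and y: "y \<in> Dalg" for \<gamma> y
  proof -
    have "y \<in> Dalg \<and> linear_extension ?q (?S \<gamma> * S j * y) = ?S \<gamma> * ?s y"
      using Supp_Dalg[OF y]
    proof (induction rule: Supp_induct)
      case zero
      have "?s (0 + 0) = ?s 0 + ?s 0" using closed(1) by (intro s_add)
      then show ?case by (simp add: linear_extension_zero closed(1))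
    next
      case (add x y)
      then show ?case by (simp add: distrib_left linear_extension_add s_add closed(3))
    next
      case (monomial r d)
      obtain \<kappa> where \<kappa>: "\<kappa> \<in> exponents n" "d = ?D \<kappa>"
        using monomial by (auto simp: Dmonomials_def)
      then have d: "d \<in> Dalg" by (simp add: Dpower_in_Dalg)
      then obtain b where b: "b \<in> Dalg" "d = \<sigma> j b" using ex by blast
      have "bij_betw (\<sigma> j) R R" using automorphism_\<sigma>_R[OF j] by (simp add: automorphism_on_def)
      then obtain a where a: "a \<in> R" "r = \<sigma> j a"
        using monomial(1) by (metis bij_betw_imp_surj_on imageE)
      then have aD: "a \<in> Dalg" using R_subset_Dalg by blast
      obtain c where c: "c \<in> R" "?S \<gamma> * a = c * ?S \<gamma>"
        using normalizes_left[OF Spower_normalizes(1) a(1)] by blast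
      have rd: "r * d = \<sigma> j (a * b)"
        using aut aD b a(2) by (simp add: automorphism_on_def)
      have sd: "?s d = b" using b by (simp add: s_\<sigma>)
      have "?S \<gamma> * S j * (r * d) = ?S \<gamma> * (S j * r) * d" by (simp add: mult.assoc)
      also have "S j * r = a * S j" using \<sigma>_S_R[OF j a(1)] a(2) by simp
      also have "?S \<gamma> * (a * S j) * d = ?S \<gamma> * a * (S j * d)" by (simp add: mult.assoc)
      also have "\<dots> = c * ?f (\<gamma>, \<kappa>)" by (simp add: c fS \<kappa> mult.assoc)
      finally have "linear_extension ?q (?S \<gamma> * S j * (r * d)) = c * ?q (?f (\<gamma>, \<kappa>))"
        using std_in_monomials[OF exponents_add[OF \<gamma> exponents_unit[OF j]] \<kappa>(1)] c(1)
        by (simp add: linear_extension_scale linear_extension_monomial)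
      also have "?q (?f (\<gamma>, \<kappa>)) = ?S \<gamma> * b"
        using inv_into_f_f[OF inj, of "(\<gamma>, \<kappa>)"] \<gamma> \<kappa> sd by simp
      also have "c * (?S \<gamma> * b) = ?S \<gamma> * (a * b)" using c(2) by (simp flip: mult.assoc)
      also have "a * b = ?s (r * d)" unfolding rd using aD b(1) closed(6) by (simp add: s_\<sigma>)
      finally show ?case using closed(6)[OF _ d] monomial(1) R_subset_Dalg by blast
    qed
    then show ?thesis ..
  qed
  fix w assume w: "w \<in> monomials"
  then obtain \<gamma> \<kappa> where gk: "\<gamma> \<in> exponents m" "\<kappa> \<in> exponents n" "w = std \<gamma> \<kappa>"
    by (auto simp: monomials_def)
  have D: "?D \<kappa> \<in> Dalg" by (simp add: Dpower_in_Dalg)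
  have "w * S j = ?S \<gamma> * S j * \<sigma> j (?D \<kappa>)"
    by (simp add: gk std_eq mult.assoc \<sigma>_S[OF j D])
  moreover have "\<sigma> j (?D \<kappa>) \<in> Dalg" "?s (\<sigma> j (?D \<kappa>)) = ?D \<kappa>"
    using bij D by (auto simp: bij_betw_def inv_into_f_f)
  ultimately show "linear_extension ?q (w * S j) = w"
    using q[OF gk(1)] by (simp add: gk std_eq)
qed

lemma right_regular_mult: "right_regular u \<Longrightarrow> right_regular v \<Longrightarrow> right_regular (u * v)"
  unfolding right_regular_def by (metis mult.assoc)

lemma right_regular_power_product:
  assumes "\<And>i. i < k \<Longrightarrow> right_regular (X i)" shows "right_regular (power_product X k \<alpha>)"
proof -
  have one: "right_regular 1" by (simp add: right_regular_def)
  have "right_regular (u ^ i)" if "right_regular u" for u i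
    using that by (induction i) (auto intro: one right_regular_mult)
  then show ?thesis
    using assms by (induction k) (auto intro: one right_regular_mult)
qed

lemma times_monomial_eq_zero_iff: "u \<in> monomials \<Longrightarrow> x * u = 0 \<longleftrightarrow> x = 0"
proof -
  assume "u \<in> monomials"
  then have "right_regular u"
    by (auto simp: monomials_def std_eq intro!: right_regular_mult right_regular_power_product
        right_regular_D right_regular_S)
  then show ?thesis by (auto simp: right_regular_def)
qed

end

section \<open>Least common multiples and Dickson's lemma\<close>

lemma ex_subseq_mono_nat:
  fixes s :: "nat \<Rightarrow> nat"
  shows "\<exists>f :: nat \<Rightarrow> nat. strict_mono f \<and> mono (\<lambda>k. s (f k))"
proof -
  obtain f where f: "strict_mono f" "monoseq (\<lambda>k. s (f k))"
    using seq_monosub[of s] by blast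
  show ?thesis
  proof (cases "incseq (\<lambda>k. s (f k))")
    case True
    then show ?thesis using f(1) by blast
  next
    case False
    then have dec: "decseq (\<lambda>k. s (f k))"
      using f(2) by (simp add: monoseq_iff)
    obtain N where N: "\<And>k. s (f N) \<le> s (f k)"
      using ex_has_least_nat[of "\<lambda>_. True" 0 "\<lambda>k. s (f k)"] by blast
    have "s (f (k + N)) = s (f N)" for k
      using N[of "k + N"] decseqD[OF dec, of N "k + N"] by simp
    then have "mono (\<lambda>k. s (f (k + N)))" by (simp add: mono_def)
    moreover have "strict_mono (\<lambda>k. f (k + N))"
      using f(1) by (simp add: strict_mono_def)
    ultimately show ?thesis by blast
  qed
qed

text \<open>Thinning out the sequence once for each coordinate makes all coordinates monotone.\<close>
lemma dickson_subsequence: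
  fixes x :: "nat \<Rightarrow> nat \<Rightarrow> nat"
  shows "\<exists>f :: nat \<Rightarrow> nat. strict_mono f \<and> (\<forall>i<N. mono (\<lambda>k. x (f k) i))"
proof (induction N)
  case 0
  then show ?case using strict_mono_id by (auto simp: id_def)
next
  case (Suc N)
  then obtain f :: "nat \<Rightarrow> nat" where f: "strict_mono f" "\<forall>i<N. mono (\<lambda>k. x (f k) i)" by blast
  obtain g :: "nat \<Rightarrow> nat" where g: "strict_mono g" "mono (\<lambda>k. x (f (g k)) N)"
    using ex_subseq_mono_nat[of "\<lambda>k. x (f k) N"] by blast
  have "mono (\<lambda>k. x (f (g k)) i)" if "i < N" for i
    using f(2) that strict_mono_mono[OF g(1)] by (auto simp: mono_def)
  then have "\<forall>i<Suc N. mono (\<lambda>k. x (f (g k)) i)"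
    using g(2) by (simp add: less_Suc_eq)
  moreover have "strict_mono (\<lambda>k. f (g k))"
    using f(1) g(1) by (simp add: strict_mono_def)
  ultimately show ?case by blast
qed

context dd_algebra_field
begin

lemma exp_dvd_std:
  assumes "\<alpha> \<in> exponents m" "\<beta> \<in> exponents n" "\<alpha>' \<in> exponents m" "\<beta>' \<in> exponents n"
  shows "exp_dvd (std \<alpha> \<beta>) (std \<alpha>' \<beta>') \<longleftrightarrow> (\<forall>i. \<alpha> i \<le> \<alpha>' i) \<and> (\<forall>i. \<beta> i \<le> \<beta>' i)"
proof (rule iffI)
  assume "exp_dvd (std \<alpha> \<beta>) (std \<alpha>' \<beta>')"
  then obtain a b c d where *: "a \<in> exponents m" "b \<in> exponents n" "c \<in> exponents m" "d \<in> exponents n"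
    "std \<alpha> \<beta> = std a b" "std \<alpha>' \<beta>' = std (\<lambda>i. c i + a i) (\<lambda>i. d i + b i)"
    unfolding exp_dvd_def by blast
  then have "\<alpha> = a \<and> \<beta> = b" using std_inject[OF assms(1,2) *(1,2)] by blast
  moreover have "\<alpha>' = (\<lambda>i. c i + a i) \<and> \<beta>' = (\<lambda>i. d i + b i)"
    using std_inject[OF assms(3,4) exponents_add[OF *(3,1)] exponents_add[OF *(4,2)]] *(6) by blast
  ultimately show "(\<forall>i. \<alpha> i \<le> \<alpha>' i) \<and> (\<forall>i. \<beta> i \<le> \<beta>' i)" by simp
next
  assume le: "(\<forall>i. \<alpha> i \<le> \<alpha>' i) \<and> (\<forall>i. \<beta> i \<le> \<beta>' i)"
  have "(\<lambda>i. \<alpha>' i - \<alpha> i) \<in> exponents m" "(\<lambda>i. \<beta>' i - \<beta> i) \<in> exponents n"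
    using assms by (simp_all add: exponents_def)
  moreover have "\<alpha>' = (\<lambda>i. \<alpha>' i - \<alpha> i + \<alpha> i)" "\<beta>' = (\<lambda>i. \<beta>' i - \<beta> i + \<beta> i)"
    using le by simp_all
  ultimately show "exp_dvd (std \<alpha> \<beta>) (std \<alpha>' \<beta>')"
    unfolding exp_dvd_def using assms by metis
qed

lemma lclm_std:
  assumes "\<alpha> \<in> exponents m" "\<beta> \<in> exponents n" "\<alpha>' \<in> exponents m" "\<beta>' \<in> exponents n"
  shows "lclm (std \<alpha> \<beta>) (std \<alpha>' \<beta>') = std (\<lambda>i. max (\<alpha> i) (\<alpha>' i)) (\<lambda>i. max (\<beta> i) (\<beta>' i))"
  unfolding lclm_def
proof (rule the_equality)
  show "\<exists>a\<in>exponents m. \<exists>b\<in>exponents n. \<exists>a'\<in>exponents m. \<exists>b'\<in>exponents n.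
     std \<alpha> \<beta> = std a b \<and> std \<alpha>' \<beta>' = std a' b' \<and>
     std (\<lambda>i. max (\<alpha> i) (\<alpha>' i)) (\<lambda>i. max (\<beta> i) (\<beta>' i)) =
       std (\<lambda>i. max (a i) (a' i)) (\<lambda>j. max (b j) (b' j))"
    using assms by blast
next
  fix w assume "\<exists>a\<in>exponents m. \<exists>b\<in>exponents n. \<exists>a'\<in>exponents m. \<exists>b'\<in>exponents n.
     std \<alpha> \<beta> = std a b \<and> std \<alpha>' \<beta>' = std a' b' \<and>
     w = std (\<lambda>i. max (a i) (a' i)) (\<lambda>j. max (b j) (b' j))"
  then obtain a b a' b' where *: "a \<in> exponents m" "b \<in> exponents n" "a' \<in> exponents m" "b' \<in> exponents n"
     "std \<alpha> \<beta> = std a b" "std \<alpha>' \<beta>' = std a' b'"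
     "w = std (\<lambda>i. max (a i) (a' i)) (\<lambda>j. max (b j) (b' j))" by blast
  have "\<alpha> = a \<and> \<beta> = b" "\<alpha>' = a' \<and> \<beta>' = b'"
    using std_inject[OF assms(1,2) *(1,2)] std_inject[OF assms(3,4) *(3,4)] *(5,6) by blast+
  then show "w = std (\<lambda>i. max (\<alpha> i) (\<alpha>' i)) (\<lambda>i. max (\<beta> i) (\<beta>' i))" using *(7) by simp
qed

lemma exponents_max: "\<alpha> \<in> exponents k \<Longrightarrow> \<beta> \<in> exponents k \<Longrightarrow> (\<lambda>i. max (\<alpha> i) (\<beta> i)) \<in> exponents k"
  by (simp add: exponents_def)

lemma
  assumes "u \<in> monomials" "v \<in> monomials"
  shows lclm_in_monomials: "lclm u v \<in> monomials"
    and lclm_left: "right_divisible (lclm u v) u" and lclm_right: "right_divisible (lclm u v) v"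
    and lclm_commute: "lclm u v = lclm v u"
    and lclm_least: "w \<in> monomials \<Longrightarrow> right_divisible w u \<Longrightarrow> right_divisible w v \<Longrightarrow>
           right_divisible w (lclm u v)"
proof -
  obtain \<alpha> \<beta> where u: "\<alpha> \<in> exponents m" "\<beta> \<in> exponents n" "u = std \<alpha> \<beta>"
    using assms(1) by (auto simp: monomials_def)
  obtain \<alpha>' \<beta>' where v: "\<alpha>' \<in> exponents m" "\<beta>' \<in> exponents n" "v = std \<alpha>' \<beta>'"
    using assms(2) by (auto simp: monomials_def)
  note max = exponents_max[OF u(1) v(1)] exponents_max[OF u(2) v(2)]
  note lclm = lclm_std[OF u(1,2) v(1,2)]
  show in_M: "lclm u v \<in> monomials"
    using std_in_monomials[OF max] by (simp add: u v lclm)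
  show "lclm u v = lclm v u"
    using lclm_std[OF v(1,2) u(1,2)] by (simp add: u v lclm max.commute)
  show "right_divisible (lclm u v) u"
    unfolding right_divisible_iff_exp_dvd[OF assms(1) in_M]
    by (simp add: u(3) v(3) lclm exp_dvd_std[OF u(1,2) max])
  show "right_divisible (lclm u v) v"
    unfolding right_divisible_iff_exp_dvd[OF assms(2) in_M]
    by (simp add: u(3) v(3) lclm exp_dvd_std[OF v(1,2) max])
  assume w: "w \<in> monomials"
  then obtain \<gamma> \<kappa> where gk: "\<gamma> \<in> exponents m" "\<kappa> \<in> exponents n" "w = std \<gamma> \<kappa>"
    by (auto simp: monomials_def)
  assume "right_divisible w u" "right_divisible w v"
  then show "right_divisible w (lclm u v)"
    unfolding right_divisible_iff_exp_dvd[OF assms(1) w] right_divisible_iff_exp_dvd[OF assms(2) w]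
      right_divisible_iff_exp_dvd[OF in_M w]
    by (simp add: u(3) v(3) gk(3) lclm exp_dvd_std u(1,2) v(1,2) gk(1,2) max)
qed

text \<open>Both exponent vectors are joined into one vector with \<open>m + n\<close> coordinates.\<close>
lemma dickson_monomials:
  fixes w :: "nat \<Rightarrow> 'a"
  assumes w: "\<And>i. w i \<in> monomials"
  shows "\<exists>i j. i < j \<and> right_divisible (w j) (w i)"
proof -
  have "\<exists>\<alpha> \<beta>. \<alpha> \<in> exponents m \<and> \<beta> \<in> exponents n \<and> w i = std \<alpha> \<beta>" for i
    using w[of i] by (auto simp: monomials_def)
  then obtain \<alpha> \<beta> where ab: "\<And>i. \<alpha> i \<in> exponents m" "\<And>i. \<beta> i \<in> exponents n"
    "\<And>i. w i = std (\<alpha> i) (\<beta> i)"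
    by metis
  let ?x = "\<lambda>k i. if i < m then \<alpha> k i else \<beta> k (i - m)"
  obtain f :: "nat \<Rightarrow> nat" where f: "strict_mono f" "\<forall>i<m + n. mono (\<lambda>k. ?x (f k) i)"
    using dickson_subsequence[of "m + n" ?x] by blast
  have le: "?x (f 0) i \<le> ?x (f 1) i" if "i < m + n" for i
    using monoD[OF f(2)[rule_format, OF that], of 0 1] by simp
  have "\<alpha> (f 0) i \<le> \<alpha> (f 1) i" for i
    using le[of i] ab(1) by (cases "i < m") (auto simp: exponents_def)
  moreover have "\<beta> (f 0) i \<le> \<beta> (f 1) i" for i
    using le[of "i + m"] ab(2) by (cases "i < n") (auto simp: exponents_def)
  ultimately have "exp_dvd (w (f 0)) (w (f 1))"
    by (simp add: ab exp_dvd_std)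
  then have "right_divisible (w (f 1)) (w (f 0))" by (rule exp_dvd_imp_right_divisible)
  moreover have "f 0 < f 1" using f(1) by (simp add: strict_mono_def)
  ultimately show ?thesis by blast
qed

lemma Supp_times_right_divisible:
  "u \<in> monomials \<Longrightarrow> w \<in> Supp (x * u) \<Longrightarrow> right_divisible w u"
  using Supp_times_monomial exp_dvd_imp_right_divisible by blast

end

section \<open>Leading monomials\<close>

locale dd_algebra_field_order =
  dd_algebra_field scale R m n S D \<sigma> \<delta> + dd_algebra_order scale R m n S D \<sigma> \<delta> gt
  for scale :: "'k::field \<Rightarrow> 'a::ring_1 \<Rightarrow> 'a" (infixr "*s" 75)
    and R :: "'a set" and m n :: nat
    and S D :: "nat \<Rightarrow> 'a"
    and \<sigma> \<delta> :: "nat \<Rightarrow> 'a \<Rightarrow> 'a"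
    and gt :: "'a \<Rightarrow> 'a \<Rightarrow> bool" (infix "\<succ>" 50) +
  assumes ordering: "dd_monomial_ordering"
begin

lemma gt_irrefl: "u \<in> monomials \<Longrightarrow> \<not> u \<succ> u"
  using ordering by (auto simp: dd_monomial_ordering_def irreflp_on_def)

lemma gt_trans:
  "u \<succ> v \<Longrightarrow> v \<succ> w \<Longrightarrow> u \<in> monomials \<Longrightarrow> v \<in> monomials \<Longrightarrow> w \<in> monomials \<Longrightarrow> u \<succ> w"
  using ordering transp_onD[of monomials "(\<succ>)" u v w] by (simp add: dd_monomial_ordering_def)

lemma gt_total: "u \<in> monomials \<Longrightarrow> v \<in> monomials \<Longrightarrow> u \<noteq> v \<Longrightarrow> u \<succ> v \<or> v \<succ> u"
  using ordering totalp_onD[of monomials "(\<succ>)" u v] by (simp add: dd_monomial_ordering_def)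

lemma gt_induct [consumes 1, case_names less]:
  assumes "t \<in> monomials"
    and "\<And>t. t \<in> monomials \<Longrightarrow> (\<And>s. s \<in> monomials \<Longrightarrow> t \<succ> s \<Longrightarrow> P s) \<Longrightarrow> P t"
  shows "P t"
proof -
  have "wfp_on monomials (\<lambda>u v. v \<succ> u)"
    using ordering by (simp add: dd_monomial_ordering_def)
  then have "\<forall>t\<in>monomials. P t"
    unfolding wfp_on_def using assms(2) by (elim allE[of _ P]) blast
  then show ?thesis using assms(1) ..
qed

lemma lm_mono_mult:
  "u \<in> monomials \<Longrightarrow> v \<in> monomials \<Longrightarrow> f \<noteq> 0 \<Longrightarrow> u \<succ> v \<Longrightarrow> lm (f * u) \<succ> lm (f * v)"
  using ordering by (simp add: dd_monomial_ordering_def)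

lemma ex_greatest:
  assumes "finite K" "K \<noteq> {}" "K \<subseteq> monomials"
  shows "\<exists>t\<in>K. \<forall>v\<in>K. v \<noteq> t \<longrightarrow> t \<succ> v"
  using assms
proof (induction K rule: finite_ne_induct)
  case (insert u K)
  then obtain t where t: "t \<in> K" "\<forall>v\<in>K. v \<noteq> t \<longrightarrow> t \<succ> v" by auto
  then have tM: "t \<in> monomials" and uM: "u \<in> monomials" and ut: "u \<noteq> t"
    using insert by auto
  show ?case
  proof (cases "t \<succ> u")
    case True
    then show ?thesis using t by auto
  next
    case False
    then have "u \<succ> t" using gt_total tM uM ut by blast
    then have "u \<succ> v" if "v \<in> K" for v
      using t(2) that gt_trans[OF _ _ uM tM, of v] insert.prems by (cases "v = t") auto
    then show ?thesis by auto
  qed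
qed simp

lemma lm_eqI:
  assumes t: "t \<in> Supp f" "\<And>v. v \<in> Supp f \<Longrightarrow> v \<noteq> t \<Longrightarrow> t \<succ> v"
  shows "lm f = t"
  unfolding lm_def
proof (rule the_equality)
  show "t \<in> Supp f \<and> (\<forall>v\<in>Supp f. v \<noteq> t \<longrightarrow> t \<succ> v)" using t by blast
  fix w assume w: "w \<in> Supp f \<and> (\<forall>v\<in>Supp f. v \<noteq> w \<longrightarrow> w \<succ> v)"
  show "w = t"
  proof (rule ccontr)
    assume "w \<noteq> t"
    then have "w \<succ> t" "t \<succ> w" using w t by auto
    then show False
      using gt_trans[of w t w] gt_irrefl[of w] w t(1) by (simp add: Supp_def)
  qed
qed

lemma lm_in_Supp: "f \<noteq> 0 \<Longrightarrow> lm f \<in> Supp f"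
  and lm_greatest: "v \<in> Supp f \<Longrightarrow> v \<noteq> lm f \<Longrightarrow> lm f \<succ> v"
proof -
  have *: "lm f \<in> Supp f \<and> (\<forall>v\<in>Supp f. v \<noteq> lm f \<longrightarrow> lm f \<succ> v)" if nz: "f \<noteq> 0"
  proof -
    have "Supp f \<noteq> {}" using nz by (simp add: Supp_empty_iff)
    then obtain t where t: "t \<in> Supp f" "\<forall>v\<in>Supp f. v \<noteq> t \<longrightarrow> t \<succ> v"
      using ex_greatest[OF finite_Supp _ Supp_subset_monomials] by blast
    then have "lm f = t" by (intro lm_eqI) auto
    then show ?thesis using t by simp
  qed
  show "f \<noteq> 0 \<Longrightarrow> lm f \<in> Supp f" using * by blast
  show "v \<in> Supp f \<Longrightarrow> v \<noteq> lm f \<Longrightarrow> lm f \<succ> v"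
    using * by (cases "f = 0") auto
qed

lemma lm_in_monomials: "f \<noteq> 0 \<Longrightarrow> lm f \<in> monomials"
  using lm_in_Supp Supp_subset_monomials by blast

lemma lc_in_R: "lc f \<in> R"
  by (simp add: lc_def coeffs_in_R)

lemma lc_nonzero: "f \<noteq> 0 \<Longrightarrow> lc f \<noteq> 0"
  using lm_in_Supp[of f] by (simp add: lc_def in_Supp_iff)

lemma lm_cong_Supp: "Supp f = Supp g \<Longrightarrow> lm f = lm g"
  by (simp add: lm_def)

lemma lm_monomial: "w \<in> monomials \<Longrightarrow> lm w = w"
  by (intro lm_eqI) (auto simp: Supp_monomial)

text \<open>This encodes the condition \<open>x = 0 \<or> t \<succ> lm x\<close> (\<open>below_iff_lm\<close>) by a property of all monomials of \<open>x\<close>,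
which makes it evidently closed under sums.\<close>
definition below :: "'a \<Rightarrow> 'a set" where
  "below t = {x. \<forall>w\<in>Supp x. t \<succ> w}"

lemma below_zero: "0 \<in> below t"
  by (simp add: below_def)

lemma below_add: "x \<in> below t \<Longrightarrow> y \<in> below t \<Longrightarrow> x + y \<in> below t"
  using Supp_add[of x y] by (auto simp: below_def)

lemma below_diff: "x \<in> below t \<Longrightarrow> y \<in> below t \<Longrightarrow> x - y \<in> below t"
  using Supp_diff[of x y] by (auto simp: below_def)

lemma below_iff_lm:
  "t \<in> monomials \<Longrightarrow> x \<in> below t \<longleftrightarrow> x = 0 \<or> t \<succ> lm x"
proof (cases "x = 0")
  case False
  assume t: "t \<in> monomials"
  note M = lm_in_monomials[OF False]
  have "t \<succ> w" if "t \<succ> lm x" "w \<in> Supp x" for w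
  proof (cases "w = lm x")
    case ne: False
    have "w \<in> monomials" using that(2) Supp_subset_monomials by blast
    then show ?thesis using gt_trans[OF that(1) lm_greatest[OF that(2) ne] t M] by blast
  qed (use that in simp)
  then show ?thesis using False lm_in_Supp[OF False] by (auto simp: below_def)
qed (simp add: below_zero)

lemma leading_term_unique:
  assumes t: "t \<in> monomials" and c: "c \<in> R" "c \<noteq> 0" and z: "f - c * t \<in> below t"
  shows "f \<noteq> 0" "lm f = t" "lc f = c"
proof -
  have *: "coeffs (f - c * t) v = coeffs f v - (if v = t then c else 0)" for v
    using c t by (simp add: coeffs_diff coeffs_scale coeffs_monomial)
  have "coeffs (f - c * t) t = 0" using z gt_irrefl[OF t] by (auto simp: below_def in_Supp_iff)
  then have ct: "coeffs f t = c" by (simp add: *)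
  then show "f \<noteq> 0" using c by auto
  show lm: "lm f = t"
    using z ct c(2) by (intro lm_eqI) (auto simp: below_def in_Supp_iff *)
  show "lc f = c" using ct by (simp add: lc_def lm)
qed

lemma tail_below:
  assumes "f \<noteq> 0" shows "f - lt f \<in> below (lm f)"
proof -
  have "coeffs (f - lt f) (lm f) = 0"
    using lm_in_monomials[OF assms] lc_in_R
    by (simp add: coeffs_diff lt_def coeffs_scale coeffs_monomial) (simp add: lc_def)
  moreover have "Supp (f - lt f) \<subseteq> Supp f"
  proof -
    have "Supp (lt f) \<subseteq> Supp f"
      unfolding lt_def using lc_in_R lm_in_monomials[OF assms] lm_in_Supp[OF assms]
      by (rule Supp_scaled_monomial)
    then show ?thesis using Supp_diff[of f "lt f"] by blast
  qed
  ultimately have "w \<in> Supp f \<and> w \<noteq> lm f" if "w \<in> Supp (f - lt f)" for w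
    using that by (auto simp: in_Supp_iff[of _ "f - lt f"])
  then show ?thesis using lm_greatest[of _ f] by (simp add: below_def)
qed

text \<open>The scalar moves across \<open>u\<close> to the right end of the product, where it does not affect the support.\<close>
lemma times_scaled_monomial:
  assumes "u \<in> monomials" "r \<in> R" "r \<noteq> 0"
  shows "Supp (h * (r * u)) = Supp (h * u)"
proof -
  obtain s where s: "s \<in> R" "s \<noteq> 0" "r * u = u * s" using R_times_monomial[OF assms] .
  then show ?thesis using Supp_times_R[OF s(1,2), of "h * u"] by (simp add: mult.assoc)
qed

text \<open>The ordering compares \<open>h * u\<close> with \<open>h * w\<close> only for monomials \<open>w\<close>. The coefficients of \<open>x\<close> stand
between \<open>h\<close> and these monomials, but they do not change the supports.\<close>
lemma mult_below:
  assumes u: "u \<in> monomials" and h: "h \<noteq> 0" and x: "x \<in> below u"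
  shows "h * x \<in> below (lm (h * u))"
proof -
  have hu: "lm (h * u) \<in> monomials"
    using h u by (simp add: lm_in_monomials times_monomial_eq_zero_iff)
  have "Supp x \<subseteq> {w. u \<succ> w}" using x by (auto simp: below_def)
  then show ?thesis
  proof (induction rule: Supp_induct)
    case (monomial r w)
    show ?case
    proof (cases "r = 0")
      case False
      have "h * w \<in> below (lm (h * u))"
        using lm_mono_mult[OF u monomial(2) h] monomial(3) below_iff_lm[OF hu] by simp
      then show ?thesis
        using times_scaled_monomial[OF monomial(2,1) False, of h] by (simp add: below_def)
    qed (simp add: below_zero)
  qed (simp_all add: below_zero below_add distrib_left)
qed

text \<open>The contribution of the tail of \<open>f\<close> lies below that of its leading term.\<close>
lemma
  assumes h: "h \<noteq> 0" and f: "f \<noteq> 0"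
  shows lm_mult: "lm (h * f) = lm (h * lm f)" and lm_mult_lt: "lm (h * lt f) = lm (h * lm f)"
proof -
  note M = lm_in_monomials[OF f]
  let ?t = "lm (h * lm f)" and ?z = "f - lt f"
  have "h * lm f \<noteq> 0" using times_monomial_eq_zero_iff[OF M] h by simp
  then have t: "?t \<in> monomials" by (rule lm_in_monomials)
  have Supp: "Supp (h * lt f) = Supp (h * lm f)"
    unfolding lt_def by (rule times_scaled_monomial[OF M lc_in_R lc_nonzero[OF f]])
  then have nz: "h * lt f \<noteq> 0" using \<open>h * lm f \<noteq> 0\<close> by (metis Supp_empty_iff)
  show lm_lt: "lm (h * lt f) = ?t" using Supp by (rule lm_cong_Supp)
  have "h * lt f - lt (h * lt f) \<in> below ?t"
    using tail_below[OF nz] by (simp only: lm_lt)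
  moreover have "h * ?z \<in> below ?t"
    by (rule mult_below[OF M h tail_below[OF f]])
  ultimately have z: "(h * lt f - lt (h * lt f)) + h * ?z \<in> below ?t" by (rule below_add)
  have "h * f - lc (h * lt f) * ?t = (h * lt f - lt (h * lt f)) + h * ?z"
    by (simp add: lt_def[of "h * lt f"] lm_lt right_diff_distrib)
  with z have "h * f - lc (h * lt f) * ?t \<in> below ?t" by simp
  then show "lm (h * f) = ?t" by (rule leading_term_unique(2)[OF t lc_in_R lc_nonzero[OF nz]])
qed

lemma right_divisible_lm_mult:
  assumes "h \<noteq> 0" "f \<noteq> 0" shows "right_divisible (lm (h * f)) (lm f)"
proof -
  note M = lm_in_monomials[OF assms(2)]
  have "h * lm f \<noteq> 0" using times_monomial_eq_zero_iff[OF M] assms(1) by simp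
  then have "lm (h * lm f) \<in> Supp (h * lm f)" by (rule lm_in_Supp)
  then show ?thesis
    unfolding lm_mult[OF assms] by (rule Supp_times_right_divisible[OF M])
qed

lemma right_divisible_of_cofactor: "a * lt f = w \<Longrightarrow> right_divisible w (lm f)"
  by (auto simp: right_divisible_def lt_def mult.assoc[symmetric])

text \<open>If \<open>lm f\<close> divides \<open>w\<close>, then so does \<open>lt f\<close>, as the leading coefficient is invertible.\<close>
lemma ex_cofactor:
  assumes f: "f \<noteq> 0" and w: "right_divisible w (lm f)"
  shows "\<exists>a. a * lt f = w"
proof -
  obtain h where h: "w = h * lm f" using w by (auto simp: right_divisible_def)
  obtain e where "e * lc f = 1" using R_unit[OF lc_in_R lc_nonzero[OF f]] by metis
  then have "h * e * lt f = w"
    by (simp add: lt_def h mult.assoc) (metis mult.assoc mult.left_neutral)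
  then show ?thesis by blast
qed

lemma lt_cancel:
  assumes f: "f \<noteq> 0" and eq: "a * lt f = b * lt f" shows "a = b"
proof -
  have "(a - b) * lc f * lm f = 0" using eq by (simp add: lt_def left_diff_distrib mult.assoc)
  then show ?thesis
    using times_monomial_eq_zero_iff[OF lm_in_monomials[OF f], of "(a - b) * lc f"]
      R_no_zero_divisor_right[OF lc_in_R lc_nonzero[OF f], of "a - b"] by simp
qed

text \<open>A multiple \<open>a * f\<close> that is designed to hit the term \<open>c * w\<close> with its leading term does so, and all its
other monomials are smaller than \<open>w\<close>.\<close>
lemma cofactor_tail:
  assumes f: "f \<noteq> 0" and w: "w \<in> monomials" and c: "c \<in> R" and a: "a * lt f = c * w"
  shows "a * f - c * w \<in> below w"
proof (cases "a = 0")
  case True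
  then show ?thesis using a by (simp add: below_zero)
next
  case False
  note M = lm_in_monomials[OF f]
  have "c \<noteq> 0"
    using lt_cancel[OF f, of a 0] False a by auto
  then have "Supp (a * lt f) = {w}"
    unfolding a using Supp_scale[OF c] Supp_monomial[OF w] by simp
  then have "lm (a * lt f) = w"
    using lm_monomial[OF w] lm_cong_Supp[of "a * lt f" w] Supp_monomial[OF w] by simp
  then have "lm (a * lm f) = w" using lm_mult_lt[OF False f] by simp
  then have "a * (f - lt f) \<in> below w"
    using mult_below[OF M False tail_below[OF f]] by simp
  then show ?thesis by (simp add: right_diff_distrib a)
qed

lemma Spoly_eq:
  assumes "f \<noteq> 0" "g \<noteq> 0" "a * lt f = lclm (lm f) (lm g)" "b * lt g = lclm (lm f) (lm g)"
  shows "Spoly f g = a * f - b * g"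
proof -
  have "(THE f'. f' * lt f = lclm (lm f) (lm g)) = a"
    using assms by (intro the_equality) (auto intro: lt_cancel)
  moreover have "(THE g'. g' * lt g = lclm (lm f) (lm g)) = b"
    using assms by (intro the_equality) (auto intro: lt_cancel)
  ultimately show ?thesis by (simp add: Spoly_def)
qed

lemma Spoly_cofactors:
  assumes f: "f \<noteq> 0" and g: "g \<noteq> 0"
  obtains a b where "a * lt f = lclm (lm f) (lm g)" "b * lt g = lclm (lm f) (lm g)"
    "Spoly f g = a * f - b * g"
proof -
  note M = lm_in_monomials[OF f] lm_in_monomials[OF g]
  obtain a b where "a * lt f = lclm (lm f) (lm g)" "b * lt g = lclm (lm f) (lm g)"
    using ex_cofactor[OF f lclm_left[OF M]] ex_cofactor[OF g lclm_right[OF M]] by blast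
  then show ?thesis using that Spoly_eq[OF f g] by blast
qed

lemma Spoly_below:
  assumes f: "f \<noteq> 0" and g: "g \<noteq> 0" shows "Spoly f g \<in> below (lclm (lm f) (lm g))"
proof -
  let ?L = "lclm (lm f) (lm g)"
  have L: "?L \<in> monomials" using lm_in_monomials f g by (simp add: lclm_in_monomials)
  obtain a b where ab: "a * lt f = ?L" "b * lt g = ?L" "Spoly f g = a * f - b * g"
    using Spoly_cofactors[OF f g] .
  have "a * f - ?L \<in> below ?L" "b * g - ?L \<in> below ?L"
    using cofactor_tail[OF f L R_closed(2), of a] cofactor_tail[OF g L R_closed(2), of b] ab by simp_all
  from below_diff[OF this] show ?thesis by (simp add: ab)
qed

lemma Spoly_commute:
  assumes f: "f \<noteq> 0" and g: "g \<noteq> 0" shows "Spoly g f = - Spoly f g"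
proof -
  note M = lm_in_monomials[OF f] lm_in_monomials[OF g]
  obtain a b where ab: "a * lt f = lclm (lm f) (lm g)" "b * lt g = lclm (lm f) (lm g)"
    "Spoly f g = a * f - b * g"
    using Spoly_cofactors[OF f g] .
  have "Spoly g f = b * g - a * f"
    using ab(1,2) by (intro Spoly_eq[OF g f]) (simp_all add: lclm_commute[OF M])
  then show ?thesis by (simp add: ab)
qed

section \<open>Left combinations with bounded summands\<close>

text \<open>The sums of products \<open>h * g\<close> with \<open>g \<in> G\<close> in which each single summand, and not only the total, has its
monomials in \<open>T\<close>. Three choices of \<open>T\<close> are used: everything, the monomials below \<open>t\<close>, and these together with
\<open>t\<close>.\<close>
inductive_set left_combinations :: "'a set \<Rightarrow> 'a set \<Rightarrow> 'a set" for G T where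
  zero: "0 \<in> left_combinations G T"
| add: "x \<in> left_combinations G T \<Longrightarrow> g \<in> G \<Longrightarrow> Supp (h * g) \<subseteq> T \<Longrightarrow>
    x + h * g \<in> left_combinations G T"

lemma left_combinations_single:
  "g \<in> G \<Longrightarrow> Supp (h * g) \<subseteq> T \<Longrightarrow> h * g \<in> left_combinations G T"
  using left_combinations.add[OF left_combinations.zero, of g G h T] by simp

lemma left_combinations_add:
  assumes x: "x \<in> left_combinations G T" and y: "y \<in> left_combinations G T"
  shows "x + y \<in> left_combinations G T"
  using y
proof induction
  case (add y g h)
  then show ?case using left_combinations.add[of "x + y" G T g h] by (simp add: add.assoc)
qed (simp add: x)

lemma left_combinations_mono:
  assumes x: "x \<in> left_combinations G T" and sub: "G \<subseteq> G'" "T \<inter> monomials \<subseteq> T'"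
  shows "x \<in> left_combinations G' T'"
  using x
proof induction
  case (add x g h)
  then have "Supp (h * g) \<subseteq> T'" using sub(2) Supp_subset_monomials by blast
  then show ?case using add sub(1) by (intro left_combinations.add) auto
qed (rule left_combinations.zero)

lemma left_combinations_mult:
  assumes x: "x \<in> left_combinations G T"
    and h: "\<And>y. Supp y \<subseteq> T \<Longrightarrow> Supp (a * y) \<subseteq> T'"
  shows "a * x \<in> left_combinations G T'"
  using x
proof induction
  case (add x g b)
  have "Supp (a * (b * g)) \<subseteq> T'" using add.hyps by (intro h)
  then show ?case
    using left_combinations.add[OF add.IH add.hyps(2), of "a * b"] by (simp add: distrib_left mult.assoc)
qed (simp add: left_combinations.zero)

lemma left_combinations_uminus:
  "x \<in> left_combinations G T \<Longrightarrow> - x \<in> left_combinations G T"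
  using left_combinations_mult[of x G T "- 1" T] by simp

lemma left_combinations_subset_left_ideal:
  assumes "left_ideal I" "G \<subseteq> I" "x \<in> left_combinations G T" shows "x \<in> I"
  using assms(3) by induction (use assms(1,2) in \<open>auto simp: left_ideal_def\<close>)

lemma generated_left_ideal_subset:
  assumes "F \<subseteq> G" shows "generated_left_ideal F \<subseteq> left_combinations G UNIV"
  unfolding generated_left_ideal_def
proof (rule hull_minimal)
  show "F \<subseteq> left_combinations G UNIV"
    using left_combinations_single[of _ G 1 UNIV] assms by auto
  show "left_ideal (left_combinations G UNIV)"
    unfolding left_ideal_def
    by (auto intro: left_combinations.zero left_combinations_add left_combinations_mult)
qed

abbreviation combinations_below :: "'a set \<Rightarrow> 'a \<Rightarrow> 'a set" where
  "combinations_below G t \<equiv> left_combinations G {w. t \<succ> w}"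

abbreviation combinations_upto :: "'a set \<Rightarrow> 'a \<Rightarrow> 'a set" where
  "combinations_upto G t \<equiv> left_combinations G {w. t \<succ> w \<or> w = t}"

lemma below_iff_Supp: "x \<in> below t \<longleftrightarrow> Supp x \<subseteq> {w. t \<succ> w}"
  by (auto simp: below_def)

lemma combinations_below_subset: "x \<in> combinations_below G t \<Longrightarrow> x \<in> below t"
  by (induction rule: left_combinations.induct) (simp_all add: below_iff_Supp Supp_add_subset)

lemma combinations_below_mult:
  assumes u: "u \<in> monomials" and h: "h \<noteq> 0" and x: "x \<in> combinations_below G u"
  shows "h * x \<in> combinations_below G (lm (h * u))"
  using mult_below[OF u h] by (intro left_combinations_mult[OF x]) (simp add: below_iff_Supp)

lemma gt_or_eq_trans:
  assumes "s \<in> monomials" "t \<in> monomials" "s \<succ> t \<or> t = s" "w \<in> monomials" "t \<succ> w \<or> w = t"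
  shows "s \<succ> w \<or> w = s"
  using assms gt_trans by blast

text \<open>The greatest leading monomial of the finitely many nonzero summands bounds all of them. It lies in \<open>T\<close>, so
a combination below \<open>t\<close> is a combination up to some \<open>s\<close> with \<open>t \<succ> s\<close>.\<close>
lemma combinations_upto_top:
  assumes "x \<in> left_combinations G T"
  shows "x = 0 \<or> (\<exists>t\<in>T \<inter> monomials. x \<in> combinations_upto G t)"
  using assms
proof induction
  case (add x g h)
  show ?case
  proof (cases "h * g = 0")
    case True
    then show ?thesis using add.IH by simp
  next
    case False
    let ?t = "lm (h * g)"
    have t: "?t \<in> T \<inter> monomials"
      using lm_in_Supp[OF False] lm_in_monomials[OF False] add.hyps by auto
    have hg: "h * g \<in> combinations_upto G ?t"
      using lm_greatest[of _ "h * g"] add.hyps by (intro left_combinations_single) auto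
    have up: "y \<in> combinations_upto G s"
      if "y \<in> combinations_upto G r" "s \<in> monomials" "r \<in> monomials" "s \<succ> r \<or> r = s" for y r s
      using that gt_or_eq_trans[of s r] by (intro left_combinations_mono[OF that(1)]) auto
    show ?thesis
    proof (cases "x = 0")
      case True
      then show ?thesis using hg t by auto
    next
      case x: False
      then obtain s where s: "s \<in> T \<inter> monomials" "x \<in> combinations_upto G s" using add.IH by blast
      have "s \<succ> ?t \<or> ?t = s \<or> ?t \<succ> s" using gt_total[of s ?t] s t by blast
      then show ?thesis
      proof (elim disjE)
        assume "?t \<succ> s"
        then have "x \<in> combinations_upto G ?t" using up[OF s(2)] s t by blast
        then show ?thesis using hg t by (blast intro: left_combinations_add)
      qed (use up[OF hg] s t in \<open>blast intro: left_combinations_add\<close>)+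
    qed
  qed
qed simp

section \<open>Reductions and remainders\<close>

lemma reduces_byE:
  assumes "reduces_by g f f'"
  obtains a where "f' = f - a * g" "a * g \<noteq> 0" "lm (a * g) \<in> Supp f"
proof -
  obtain a w where a: "a * g \<noteq> 0" "w \<in> Supp f" "lt (a * g) = coeffs f w * w" "f' = f - a * g"
    using assms by (auto simp: reduces_by_def)
  have "Supp (coeffs f w * w) = {w}"
    using a(2) Supp_scale[OF coeffs_in_R, of f w w] Supp_monomial[of w] by (simp add: Supp_def)
  moreover have "Supp (lc (a * g) * lm (a * g)) = {lm (a * g)}"
    using Supp_scale[OF lc_in_R lc_nonzero[OF a(1)]] Supp_monomial[OF lm_in_monomials[OF a(1)]]
    by simp
  ultimately have "lm (a * g) = w" using a(3) by (simp add: lt_def)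
  then show ?thesis using that a by blast
qed

text \<open>Each step subtracts a multiple of an element of \<open>G\<close> whose leading monomial occurs in the current
element, so the bound \<open>t\<close> is never exceeded. For an S-polynomial that reduces to \<open>0\<close> this provides the
representation that Buchberger's criterion asks for.\<close>
lemma reduction_combination:
  assumes red: "(\<lambda>x y. \<exists>g\<in>G. reduces_by g x y)\<^sup>*\<^sup>* f r" and f: "f \<in> below t"
    and t: "t \<in> monomials"
  shows "r \<in> below t \<and> f - r \<in> combinations_below G t"
  using red
proof induction
  case base
  then show ?case using f by (simp add: left_combinations.zero)
next
  case (step y z)
  then obtain g where g: "g \<in> G" "reduces_by g y z" by blast
  obtain a where a: "z = y - a * g" "a * g \<noteq> 0" "lm (a * g) \<in> Supp y"
    using g(2) by (rule reduces_byE)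
  have "t \<succ> lm (a * g)" using step.IH a(3) by (simp add: below_def)
  then have ag: "a * g \<in> below t" using below_iff_lm[OF t] by simp
  have "a * g \<in> combinations_below G t"
    using g(1) ag by (intro left_combinations_single) (simp_all add: below_iff_Supp)
  then have "(f - y) + a * g \<in> combinations_below G t"
    using step.IH by (intro left_combinations_add) simp_all
  then show ?case
    using below_diff[of y t "a * g"] step.IH ag by (simp add: a(1) algebra_simps)
qed

text \<open>Let \<open>w\<close> be the greatest reducible monomial of \<open>f\<close>. The leading term of the multiple of \<open>g\<close> that is
subtracted is the term of \<open>f\<close> at \<open>w\<close>, so \<open>w\<close> disappears and every new monomial is smaller than \<open>w\<close>.\<close>
lemma reduce_greatest:
  assumes G: "0 \<notin> G" and f: "\<not> Supp f \<subseteq> Irr G"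
  shows "\<exists>w f' g. w \<in> Supp f \<and> w \<notin> Irr G \<and> g \<in> G \<and> reduces_by g f f' \<and> (\<forall>v\<in>Supp f' - Irr G. w \<succ> v)"
proof -
  have "finite (Supp f - Irr G)" "Supp f - Irr G \<noteq> {}" "Supp f - Irr G \<subseteq> monomials"
    using f finite_Supp Supp_subset_monomials by auto
  from ex_greatest[OF this] obtain w where w: "w \<in> Supp f" "w \<notin> Irr G"
    and greatest: "\<And>v. v \<in> Supp f - Irr G \<Longrightarrow> v \<noteq> w \<Longrightarrow> w \<succ> v" by blast
  have wM: "w \<in> monomials" using w(1) by (simp add: Supp_def)
  obtain g h where g: "g \<in> G" "w = h * lm g" using w(2) wM by (auto simp: Irr_def)
  have "g \<noteq> 0" using G g(1) by blast
  then obtain b where b: "b * lt g = w"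
    using ex_cofactor[of g w] g(2) by (auto simp: right_divisible_def)
  let ?c = "coeffs f w"
  let ?z = "?c * b * g - ?c * w"
  have z: "?z \<in> below w"
    by (rule cofactor_tail[OF \<open>g \<noteq> 0\<close> wM coeffs_in_R]) (simp add: b mult.assoc)
  have c: "?c \<noteq> 0" using w(1) by (simp add: in_Supp_iff)
  note lead = leading_term_unique[OF wM coeffs_in_R c z]
  have "reduces_by g f (f - ?c * b * g)"
    unfolding reduces_by_def using lead(1) w(1)
    by (intro exI[of _ "?c * b"] conjI bexI[of _ w]) (simp_all add: lt_def lead(2,3))
  moreover have "w \<succ> v" if v: "v \<in> Supp (f - ?c * b * g) - Irr G" for v
  proof (cases "v \<in> Supp ?z")
    case True
    then show ?thesis using z by (simp add: below_def)
  next
    case False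
    have "coeffs (f - ?c * b * g) v = coeffs f v - ?c * coeffs w v - coeffs ?z v"
      by (simp add: coeffs_diff coeffs_scale coeffs_in_R mult.assoc)
    then have "coeffs f v - ?c * coeffs w v \<noteq> 0"
      using v False by (simp add: in_Supp_iff)
    then have "v \<noteq> w" "coeffs f v \<noteq> 0"
      by (auto simp: coeffs_monomial[OF wM] split: if_splits)
    then show ?thesis using greatest v by (simp add: in_Supp_iff)
  qed
  ultimately show ?thesis using w g(1) by blast
qed

text \<open>Reducing the greatest reducible monomial again and again stops, because these monomials decrease in a
well-ordering.\<close>
lemma ex_remainder:
  assumes G: "0 \<notin> G" shows "\<exists>r. remainder G f r"
proof -
  let ?red = "\<lambda>x y. \<exists>g\<in>G. reduces_by g x y"
  have below: "\<exists>r. remainder G f r" if "t \<in> monomials" "\<forall>v\<in>Supp f - Irr G. t \<succ> v" for t f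
    using that
  proof (induction arbitrary: f rule: gt_induct)
    case (less t)
    show ?case
    proof (cases "Supp f \<subseteq> Irr G")
      case True
      then show ?thesis by (auto simp: remainder_def)
    next
      case False
      then obtain w f' g where w: "w \<in> Supp f" "w \<notin> Irr G" "g \<in> G" "reduces_by g f f'"
        "\<forall>v\<in>Supp f' - Irr G. w \<succ> v"
        using reduce_greatest[OF G] by blast
      have "w \<in> monomials" "t \<succ> w" using w(1,2) less.prems by (simp_all add: Supp_def)
      then obtain r where r: "remainder G f' r" using less.IH w(5) by blast
      have "?red f f'" using w by blast
      then have "remainder G f r"
        using r converse_rtranclp_into_rtranclp[of ?red f f' r] by (simp add: remainder_def)
      then show ?thesis ..
    qed
  qed
  show ?thesis
  proof (cases "Supp f \<subseteq> Irr G")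
    case True
    then show ?thesis by (auto simp: remainder_def)
  next
    case False
    then obtain w f' g where w: "w \<in> Supp f" "g \<in> G" "reduces_by g f f'"
      "\<forall>v\<in>Supp f' - Irr G. w \<succ> v"
      using reduce_greatest[OF G] by blast
    have "w \<in> monomials" using w(1) by (simp add: Supp_def)
    then obtain r where r: "remainder G f' r" using below w(4) by blast
    have "?red f f'" using w by blast
    then have "remainder G f r"
      using r converse_rtranclp_into_rtranclp[of ?red f f' r] by (simp add: remainder_def)
    then show ?thesis ..
  qed
qed

section \<open>Buchberger's criterion\<close>

definition all_Spolys_resolved :: "'a set \<Rightarrow> bool" where
  "all_Spolys_resolved G \<longleftrightarrow>
     (\<forall>p\<in>G. \<forall>q\<in>G. p \<noteq> q \<longrightarrow> Spoly p q \<in> combinations_below G (lclm (lm p) (lm q)))"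

text \<open>As \<open>t\<close> is divisible by \<open>lm p\<close> and \<open>lm q\<close>, it is a left multiple \<open>c * lclm (lm p) (lm q)\<close>. By uniqueness of
cofactors, \<open>a * p - b * q\<close> is \<open>c * Spoly p q\<close>. Multiplication by \<open>c\<close> carries the bound
\<open>lclm (lm p) (lm q)\<close> to \<open>t\<close>.\<close>
lemma cofactor_multiples_differ_by_lower:
  assumes G: "0 \<notin> G" "all_Spolys_resolved G" and p: "p \<in> G" and q: "q \<in> G" and t: "t \<in> monomials"
    and a: "a * lt p = t" and b: "b * lt q = t"
  shows "a * p - b * q \<in> combinations_below G t"
proof (cases "p = q")
  case True
  have "p \<noteq> 0" using G(1) p by blast
  then have "a = b" using lt_cancel[of p a b] a b True by simp
  then show ?thesis using True by (simp add: left_combinations.zero)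
next
  case False
  have nz: "p \<noteq> 0" "q \<noteq> 0" using G(1) p q by blast+
  note M = lm_in_monomials[OF nz(1)] lm_in_monomials[OF nz(2)]
  let ?L = "lclm (lm p) (lm q)"
  have L: "?L \<in> monomials" by (rule lclm_in_monomials[OF M])
  have dvd: "right_divisible t (lm p)" "right_divisible t (lm q)"
    using right_divisible_of_cofactor a b by blast+
  obtain c where c: "t = c * ?L"
    using lclm_least[OF M t dvd] by (auto simp: right_divisible_def)
  obtain a' b' where ab': "a' * lt p = ?L" "b' * lt q = ?L" "Spoly p q = a' * p - b' * q"
    using Spoly_cofactors[OF nz] .
  have "a = c * a'" using lt_cancel[OF nz(1), of a "c * a'"] a ab'(1) c by (simp add: mult.assoc)
  moreover have "b = c * b'"
    using lt_cancel[OF nz(2), of b "c * b'"] b ab'(2) c by (simp add: mult.assoc)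
  ultimately have "a * p - b * q = c * Spoly p q"
    by (simp add: ab'(3) right_diff_distrib mult.assoc)
  moreover have "c \<noteq> 0" using c monomial_nonzero[OF t] by auto
  moreover have "Spoly p q \<in> combinations_below G ?L"
    using G(2) p q False by (simp add: all_Spolys_resolved_def)
  ultimately show ?thesis
    using combinations_below_mult[OF L, of c "Spoly p q" G] lm_monomial[OF t] c by simp
qed

text \<open>Modulo combinations below \<open>t\<close>, the combinations up to \<open>t\<close> form the left \<open>R\<close>-module generated by the single element
\<open>b * q\<close>. A summand \<open>h * g\<close> with leading term \<open>d * t\<close> is treated in two steps: if \<open>a * lt g = t\<close>, then
\<open>h * g\<close> differs from \<open>d * a * g\<close> by the lower summand \<open>(h - d * a) * g\<close>, and \<open>a * g\<close> differs from
\<open>b * q\<close> by a lower combination.\<close>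
lemma combinations_upto_split:
  assumes G: "0 \<notin> G" "all_Spolys_resolved G" and q: "q \<in> G" and t: "t \<in> monomials"
    and b: "b * lt q = t" and x: "x \<in> combinations_upto G t"
  shows "\<exists>c\<in>R. x - c * (b * q) \<in> combinations_below G t"
  using x
proof induction
  case zero
  show ?case by (intro bexI[of _ 0]) (simp_all add: left_combinations.zero R_closed(1))
next
  case (add x g h)
  then obtain c where c: "c \<in> R" "x - c * (b * q) \<in> combinations_below G t" by blast
  show ?case
  proof (cases "h * g \<in> below t")
    case True
    then have "h * g \<in> combinations_below G t"
      using add.hyps(2) by (intro left_combinations_single) (simp_all add: below_iff_Supp)
    then have "(x - c * (b * q)) + h * g \<in> combinations_below G t"
      using c(2) by (rule left_combinations_add[rotated])
    then show ?thesis using c(1) by (intro bexI[of _ c]) (simp_all add: algebra_simps)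
  next
    case False
    have nz: "h * g \<noteq> 0" using False below_zero by auto
    then have h: "h \<noteq> 0" and g: "g \<noteq> 0" by auto
    have "lm (h * g) \<in> {w. t \<succ> w \<or> w = t}" using lm_in_Supp[OF nz] add.hyps(3) by blast
    then have lm: "lm (h * g) = t" using False below_iff_lm[OF t] by auto
    then have "right_divisible t (lm g)" using right_divisible_lm_mult[OF h g] by simp
    then obtain a where a: "a * lt g = t" using ex_cofactor[OF g] by blast
    let ?d = "lc (h * g)"
    have d: "?d \<in> R" by (rule lc_in_R)
    have "h * g - ?d * t \<in> below t"
      using tail_below[OF nz] by (simp add: lt_def lm)
    moreover have "?d * a * g - ?d * t \<in> below t"
      using a by (intro cofactor_tail[OF g t d]) (simp add: mult.assoc)
    ultimately have "(h * g - ?d * t) - (?d * a * g - ?d * t) \<in> below t" by (rule below_diff)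
    then have "(h - ?d * a) * g \<in> below t" by (simp add: algebra_simps)
    then have 1: "(h - ?d * a) * g \<in> combinations_below G t"
      using add.hyps(2) by (intro left_combinations_single) (simp_all add: below_iff_Supp)
    have "a * g - b * q \<in> combinations_below G t"
      by (rule cofactor_multiples_differ_by_lower[OF G add.hyps(2) q t a b])
    moreover have "Supp (?d * y) \<subseteq> {w. t \<succ> w}" if "Supp y \<subseteq> {w. t \<succ> w}" for y
      using Supp_scale_subset[OF d, of y] that by blast
    ultimately have 2: "?d * (a * g - b * q) \<in> combinations_below G t"
      by (rule left_combinations_mult)
    have "(x - c * (b * q)) + ((h - ?d * a) * g + ?d * (a * g - b * q)) \<in> combinations_below G t"
      by (rule left_combinations_add[OF c(2) left_combinations_add[OF 1 2]])
    also have "(x - c * (b * q)) + ((h - ?d * a) * g + ?d * (a * g - b * q))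
        = x + h * g - (c + ?d) * (b * q)"
      by (simp add: algebra_simps)
    finally show ?thesis using R_closed(3)[OF c(1) d] by blast
  qed
qed

text \<open>The leading monomial of a summand \<open>h * g\<close> is divisible by \<open>lm g\<close>, so it cannot be \<open>t\<close>.\<close>
lemma combinations_upto_below:
  assumes G: "0 \<notin> G" and t: "t \<in> monomials" and x: "x \<in> combinations_upto G t"
    and ndvd: "\<And>g. g \<in> G \<Longrightarrow> \<not> right_divisible t (lm g)"
  shows "x \<in> combinations_below G t"
  using x
proof induction
  case (add x g h)
  have "h * g \<in> below t"
  proof (cases "h * g = 0")
    case False
    then have "h \<noteq> 0" "g \<noteq> 0" by auto
    then have "lm (h * g) \<noteq> t" using right_divisible_lm_mult ndvd add.hyps(2) by metis
    then have "t \<succ> lm (h * g)" using lm_in_Supp[OF False] add.hyps(3) by blast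
    then show ?thesis using below_iff_lm[OF t] by blast
  qed (simp add: below_zero)
  then show ?case
    using add by (intro left_combinations.add) (simp_all add: below_iff_Supp)
qed (rule left_combinations.zero)

text \<open>By well-founded induction on the bound \<open>t\<close>: it is the leading monomial of \<open>f\<close>, or it can be lowered.\<close>
lemma lm_divisible_of_combination:
  assumes G: "0 \<notin> G" "all_Spolys_resolved G" and t: "t \<in> monomials"
    and f: "f \<noteq> 0" "f \<in> combinations_upto G t"
  shows "\<exists>g\<in>G. right_divisible (lm f) (lm g)"
  using t f
proof (induction arbitrary: f rule: gt_induct)
  case (less t)
  have lower: ?case if "f \<in> combinations_below G t"
    using combinations_upto_top[OF that] less.IH less.prems(1) by blast
  show ?case
  proof (cases "\<exists>g\<in>G. right_divisible t (lm g)")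
    case False
    then show ?thesis using combinations_upto_below[OF G(1) less.hyps less.prems(2)] lower by blast
  next
    case True
    then obtain q where q: "q \<in> G" "right_divisible t (lm q)" by blast
    then have nz: "q \<noteq> 0" using G(1) by blast
    obtain b where b: "b * lt q = t" using ex_cofactor[OF nz q(2)] by blast
    obtain c where c: "c \<in> R" "f - c * (b * q) \<in> combinations_below G t"
      using combinations_upto_split[OF G q(1) less.hyps b less.prems(2)] by blast
    show ?thesis
    proof (cases "c = 0")
      case True
      then show ?thesis using c(2) lower by simp
    next
      case False
      have "c * b * q - c * t \<in> below t"
        using b by (intro cofactor_tail[OF nz less.hyps c(1)]) (simp add: mult.assoc)
      then have "(f - c * (b * q)) + (c * b * q - c * t) \<in> below t"
        using combinations_below_subset[OF c(2)] by (intro below_add)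
      then have "f - c * t \<in> below t" by (simp add: mult.assoc)
      then have "lm f = t" by (rule leading_term_unique(2)[OF less.hyps c(1) False])
      then show ?thesis using q by blast
    qed
  qed
qed

lemma buchberger_criterion:
  assumes G: "0 \<notin> G" "all_Spolys_resolved G" and I: "G \<subseteq> I" "I \<subseteq> left_combinations G UNIV"
  shows "left_GS_basis I G"
proof -
  have "\<exists>g\<in>G. right_divisible (lm f) (lm g)" if f: "f \<in> I" "f \<noteq> 0" for f
  proof -
    have "f \<in> left_combinations G UNIV" using f(1) I(2) by blast
    then obtain t where "t \<in> monomials" "f \<in> combinations_upto G t"
      using combinations_upto_top f(2) by blast
    then show ?thesis using lm_divisible_of_combination[OF G] f(2) by blast
  qed
  then show ?thesis using G I by (simp add: left_GS_basis_def)
qed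

end

section \<open>The algorithm\<close>

lemma left_ideal_generated: "left_ideal (generated_left_ideal F)"
  unfolding generated_left_ideal_def
proof (rule hull_in)
  fix T :: "'a set set" assume "Ball T left_ideal"
  then show "left_ideal (\<Inter>T)" by (auto simp: left_ideal_def)
qed

lemma left_ideal_diff:
  assumes "left_ideal I" "x \<in> I" "y \<in> I" shows "x - y \<in> I"
proof -
  have "- 1 * y \<in> I" using assms(1,3) unfolding left_ideal_def by blast
  then have "x + - 1 * y \<in> I" using assms(1,2) unfolding left_ideal_def by blast
  then show ?thesis by simp
qed

context dd_algebra_field_order
begin

text \<open>An S-polynomial that is resolved by \<open>G\<close> stays resolved when \<open>G\<close> grows, so each pair has to be treated
only once: when it leaves \<open>P\<close>.\<close>
definition gs_invariant :: "'a set \<Rightarrow> 'a set \<times> 'a set set \<Rightarrow> bool" where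
  "gs_invariant F s \<longleftrightarrow> (case s of (G, P) \<Rightarrow>
     finite G \<and> finite P \<and> 0 \<notin> G \<and> F \<subseteq> G \<and> G \<subseteq> generated_left_ideal F \<and>
     (\<forall>X\<in>P. \<exists>p\<in>G. \<exists>q\<in>G. X = {p, q}) \<and>
     (\<forall>p\<in>G. \<forall>q\<in>G. p \<noteq> q \<longrightarrow> {p, q} \<in> P \<or>
        Spoly p q \<in> combinations_below G (lclm (lm p) (lm q))))"

lemma gs_invariantD:
  assumes "gs_invariant F (G, P)"
  shows "finite G" "finite P" "0 \<notin> G" "F \<subseteq> G" "G \<subseteq> generated_left_ideal F"
    "X \<in> P \<Longrightarrow> \<exists>p\<in>G. \<exists>q\<in>G. X = {p, q}"
    "p \<in> G \<Longrightarrow> q \<in> G \<Longrightarrow> p \<noteq> q \<Longrightarrow> {p, q} \<notin> P \<Longrightarrow>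
       Spoly p q \<in> combinations_below G (lclm (lm p) (lm q))"
proof -
  note inv = assms[unfolded gs_invariant_def case_prod_conv]
  show "finite G" "finite P" "0 \<notin> G" "F \<subseteq> G" "G \<subseteq> generated_left_ideal F"
    "X \<in> P \<Longrightarrow> \<exists>p\<in>G. \<exists>q\<in>G. X = {p, q}"
    using inv by simp_all
  show "p \<in> G \<Longrightarrow> q \<in> G \<Longrightarrow> p \<noteq> q \<Longrightarrow> {p, q} \<notin> P \<Longrightarrow>
       Spoly p q \<in> combinations_below G (lclm (lm p) (lm q))"
    using inv by blast
qed

lemma gs_invariant_init:
  assumes "finite F" "0 \<notin> F" shows "gs_invariant F (gs_init F)"
proof -
  let ?P = "{{p, q} |p q. p \<in> F \<and> q \<in> F \<and> p \<noteq> q}"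
  have "?P \<subseteq> Pow F" by auto
  then have "finite ?P" using assms(1) finite_subset by blast
  moreover have "F \<subseteq> generated_left_ideal F"
    by (simp add: generated_left_ideal_def hull_subset)
  moreover have "\<forall>X\<in>?P. \<exists>p\<in>F. \<exists>q\<in>F. X = {p, q}" by blast
  moreover have "{p, q} \<in> ?P" if "p \<in> F" "q \<in> F" "p \<noteq> q" for p q using that by blast
  ultimately show ?thesis
    using assms by (simp add: gs_invariant_def gs_init_def)
qed

lemma gs_pair_members:
  assumes "gs_invariant F (G, P)" "{p, q} \<in> P"
  shows "p \<in> G" "q \<in> G"
proof -
  obtain p' q' where "p' \<in> G" "q' \<in> G" "{p, q} = {p', q'}"
    using gs_invariantD(6)[OF assms] by blast
  then show "p \<in> G" "q \<in> G" unfolding doubleton_eq_iff by blast+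
qed

lemma nonzero_remainder_lm_in_Irr:
  "remainder G x r \<Longrightarrow> r \<noteq> 0 \<Longrightarrow> lm r \<in> Irr G"
  using lm_in_Supp[of r] by (auto simp: remainder_def)

text \<open>The leading monomial of \<open>r\<close> is irreducible modulo \<open>G\<close>, whereas those of the elements of \<open>G\<close> divide
themselves. So a step with a nonzero remainder strictly enlarges \<open>G\<close>.\<close>
lemma nonzero_remainder_not_in:
  assumes "remainder G x r" "r \<noteq> 0" shows "r \<notin> G"
proof
  assume "r \<in> G"
  moreover have "\<forall>g\<in>G. \<forall>h. lm r \<noteq> h * lm g"
    using nonzero_remainder_lm_in_Irr[OF assms] by (simp add: Irr_def)
  ultimately have "lm r \<noteq> 1 * lm r" by blast
  then show False by simp
qed

text \<open>\<open>Spoly p q - r\<close> is a combination of elements of \<open>G\<close> below the least common multiple, and so is \<open>r = 1 * r\<close>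
once \<open>r\<close> belongs to \<open>G\<close>. Hence the pair that was removed is resolved in both cases. A pair is an unordered
set, so the S-polynomial \<open>Spoly q p = - Spoly p q\<close> has to be covered as well.\<close>
lemma gs_invariant_step:
  assumes step: "gs_step s s'" and inv: "gs_invariant F s"
  shows "gs_invariant F s'"
proof -
  let ?I = "generated_left_ideal F"
  \<comment> \<open>What one step learns about the pair that it removes.\<close>
  have key: "Spoly p q - r \<in> combinations_below G (lclm (lm p) (lm q))"
    "Supp r \<subseteq> {w. lclm (lm p) (lm q) \<succ> w}" "r \<in> ?I"
    if inv: "gs_invariant F (G, P)" and pq: "{p, q} \<in> P" and r: "remainder G (Spoly p q) r"
    for G P p q r
  proof -
    note G = gs_invariantD(3,5)[OF inv]
    note mem = gs_pair_members[OF inv pq]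
    have nz: "p \<noteq> 0" "q \<noteq> 0" using mem G by blast+
    have L: "lclm (lm p) (lm q) \<in> monomials"
      using lm_in_monomials nz by (simp add: lclm_in_monomials)
    have *: "r \<in> below (lclm (lm p) (lm q)) \<and>
        Spoly p q - r \<in> combinations_below G (lclm (lm p) (lm q))"
      using r by (intro reduction_combination[OF _ Spoly_below[OF nz] L]) (simp add: remainder_def)
    then show "Spoly p q - r \<in> combinations_below G (lclm (lm p) (lm q))"
      "Supp r \<subseteq> {w. lclm (lm p) (lm q) \<succ> w}"
      by (simp_all add: below_iff_Supp)
    obtain a b where "Spoly p q = a * p - b * q" by (rule Spoly_cofactors[OF nz])
    moreover have "a * p \<in> ?I" "b * q \<in> ?I"
      using mem G(2) left_ideal_generated[of F] unfolding left_ideal_def by blast+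
    ultimately have "Spoly p q \<in> ?I" using left_ideal_diff[OF left_ideal_generated] by simp
    moreover have "Spoly p q - r \<in> ?I"
      using left_combinations_subset_left_ideal[OF left_ideal_generated G(2)] * by blast
    ultimately have "Spoly p q - (Spoly p q - r) \<in> ?I"
      by (rule left_ideal_diff[OF left_ideal_generated])
    then show "r \<in> ?I" by simp
  qed
  \<comment> \<open>Old pairs stay resolved by a larger set once the S-polynomial of the removed pair is resolved.\<close>
  have resolved: "Spoly p' q' \<in> combinations_below G' (lclm (lm p') (lm q'))"
    if inv: "gs_invariant F (G, P)" and pq: "{p, q} \<in> P" and sub: "G \<subseteq> G'"
      and S: "Spoly p q \<in> combinations_below G' (lclm (lm p) (lm q))"
      and pq': "p' \<in> G" "q' \<in> G" "p' \<noteq> q'" "{p', q'} \<notin> P - {{p, q}}" for G P p q G' p' q'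
  proof (cases "{p', q'} = {p, q}")
    case False
    then have "{p', q'} \<notin> P" using pq'(4) by blast
    then have "Spoly p' q' \<in> combinations_below G (lclm (lm p') (lm q'))"
      by (rule gs_invariantD(7)[OF inv pq'(1-3)])
    then show ?thesis by (rule left_combinations_mono) (use sub in auto)
  next
    case True
    have nz: "p \<noteq> 0" "q \<noteq> 0"
      using gs_pair_members[OF inv pq] gs_invariantD(3)[OF inv] by blast+
    note M = lm_in_monomials[OF nz(1)] lm_in_monomials[OF nz(2)]
    consider "p' = p" "q' = q" | "p' = q" "q' = p" using True by (auto simp: doubleton_eq_iff)
    then show ?thesis
    proof cases
      case 2
      then show ?thesis
        using left_combinations_uminus[OF S] Spoly_commute[OF nz] lclm_commute[OF M] by simp
    qed (use S in simp)
  qed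
  from step show ?thesis
  proof cases
    case (zero p q P G)
    note inv' = inv[unfolded zero]
    have S: "Spoly p q \<in> combinations_below G (lclm (lm p) (lm q))"
      using key(1)[OF inv' zero(3,4)] by simp
    have "\<forall>p'\<in>G. \<forall>q'\<in>G. p' \<noteq> q' \<longrightarrow> {p', q'} \<in> P - {{p, q}} \<or>
        Spoly p' q' \<in> combinations_below G (lclm (lm p') (lm q'))"
      using resolved[OF inv' zero(3) order_refl S] by blast
    moreover have "finite G \<and> finite P \<and> 0 \<notin> G \<and> F \<subseteq> G \<and> G \<subseteq> ?I \<and>
        (\<forall>X\<in>P. \<exists>p\<in>G. \<exists>q\<in>G. X = {p, q})"
      using inv' unfolding gs_invariant_def by simp
    ultimately show ?thesis unfolding zero gs_invariant_def case_prod_conv by blast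
  next
    case (nonzero p q P G r)
    note inv' = inv[unfolded nonzero]
    let ?G = "G \<union> {r}" and ?P = "(P - {{p, q}}) \<union> {{g, r} |g. g \<in> G}"
    note k = key[OF inv' nonzero(3,4)]
    have "Spoly p q - r \<in> combinations_below ?G (lclm (lm p) (lm q))"
      using k(1) by (rule left_combinations_mono) auto
    moreover have "1 * r \<in> combinations_below ?G (lclm (lm p) (lm q))"
      using k(2) by (intro left_combinations_single) simp_all
    ultimately have "(Spoly p q - r) + 1 * r \<in> combinations_below ?G (lclm (lm p) (lm q))"
      by (rule left_combinations_add)
    then have S: "Spoly p q \<in> combinations_below ?G (lclm (lm p) (lm q))" by simp
    have pairs: "\<forall>p'\<in>?G. \<forall>q'\<in>?G. p' \<noteq> q' \<longrightarrow> {p', q'} \<in> ?P \<or>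
        Spoly p' q' \<in> combinations_below ?G (lclm (lm p') (lm q'))"
    proof (intro ballI impI)
      fix p' q' assume *: "p' \<in> ?G" "q' \<in> ?G" "p' \<noteq> q'"
      show "{p', q'} \<in> ?P \<or> Spoly p' q' \<in> combinations_below ?G (lclm (lm p') (lm q'))"
      proof (cases "p' = r \<or> q' = r")
        case True
        then have "{p', q'} \<in> {{g, r} |g. g \<in> G}" using * by (auto simp: insert_commute)
        then show ?thesis by blast
      next
        case False
        then have "p' \<in> G" "q' \<in> G" using * by auto
        then show ?thesis
          using resolved[OF inv' nonzero(3) Un_upper1 S _ _ *(3)] by blast
      qed
    qed
    note old = gs_invariantD(1-6)[OF inv']
    have "\<exists>p\<in>?G. \<exists>q\<in>?G. X = {p, q}" if X: "X \<in> ?P" for X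
    proof (cases "X \<in> P")
      case True
      then show ?thesis using old(6)[OF True] by blast
    next
      case False
      then obtain g where "g \<in> G" "X = {g, r}" using X by blast
      then show ?thesis by (intro bexI[of _ g] bexI[of _ r]) auto
    qed
    moreover have "finite ?P" using old(1,2) by simp
    ultimately show ?thesis
      using old(1,3,4,5) k(3) nonzero(5) pairs unfolding nonzero(2) gs_invariant_def case_prod_conv
      by (intro conjI) auto
  qed
qed

lemma gs_invariant_reachable:
  assumes "finite F" "0 \<notin> F" "gs_step\<^sup>*\<^sup>* (gs_init F) s" shows "gs_invariant F s"
  using assms(3)
proof induction
  case base
  show ?case by (rule gs_invariant_init[OF assms(1,2)])
next
  case (step s s')
  then show ?case by (blast intro: gs_invariant_step)
qed

lemma gs_result_is_basis:
  assumes "finite F" "0 \<notin> F" "gs_step\<^sup>*\<^sup>* (gs_init F) (G, {})"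
  shows "finite G" "left_GS_basis (generated_left_ideal F) G"
proof -
  have inv: "gs_invariant F (G, {})" by (rule gs_invariant_reachable[OF assms])
  then show "finite G" by (simp add: gs_invariant_def)
  show "left_GS_basis (generated_left_ideal F) G"
    using inv generated_left_ideal_subset[of F G]
    by (intro buchberger_criterion) (simp_all add: gs_invariant_def all_Spolys_resolved_def)
qed

text \<open>In an infinite run, \<open>G\<close> changes only finitely often: the leading monomials of the elements added
would otherwise form an infinite sequence in which no monomial divides a later one, against Dickson's lemma.
From some point on every step only removes a pair, and the set of pairs is finite.\<close>
lemma gs_terminates:
  assumes F: "finite F" "0 \<notin> F"
  shows "\<not> (\<exists>s. s 0 = gs_init F \<and> (\<forall>i. gs_step (s i) (s (Suc i))))"
proof
  assume "\<exists>s. s 0 = gs_init F \<and> (\<forall>i. gs_step (s i) (s (Suc i)))"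
  then obtain s where s0: "s 0 = gs_init F" and step: "\<And>i. gs_step (s i) (s (Suc i))" by blast
  have inv: "gs_invariant F (s i)" for i
    by (induction i) (simp_all add: s0 gs_invariant_init[OF F] gs_invariant_step[OF step])
  define G where "G i = fst (s i)" for i
  define P where "P i = snd (s i)" for i
  have alt: "(G (Suc i) = G i \<and> P (Suc i) \<subset> P i) \<or>
      (\<exists>r. r \<noteq> 0 \<and> lm r \<in> Irr (G i) \<and> G (Suc i) = G i \<union> {r} \<and> r \<notin> G i)" for i
    using step[of i]
  proof cases
    case (zero p q P' G')
    then show ?thesis by (auto simp: G_def P_def)
  next
    case (nonzero p q P' G' r)
    then show ?thesis
      using nonzero_remainder_lm_in_Irr[OF nonzero(4,5)] nonzero_remainder_not_in[OF nonzero(4,5)]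
      by (auto simp: G_def)
  qed
  have "G i \<subseteq> G (Suc i)" for i using alt[of i] by auto
  then have mono_G: "G i \<subseteq> G j" if "i \<le> j" for i j
    using lift_Suc_mono_le[of G i j] that by simp
  let ?J = "{i. G (Suc i) \<noteq> G i}"
  have "finite ?J"
  proof (rule ccontr)
    assume inf: "infinite ?J"
    define e where "e = enumerate ?J"
    have "\<exists>r. r \<noteq> 0 \<and> lm r \<in> Irr (G (e k)) \<and> r \<in> G (Suc (e k))" for k
    proof -
      have "G (Suc (e k)) \<noteq> G (e k)" using enumerate_in_set[OF inf, of k] by (simp add: e_def)
      then show ?thesis using alt[of "e k"] by (elim disjE) auto
    qed
    then obtain r where r: "\<And>k. r k \<noteq> 0" "\<And>k. lm (r k) \<in> Irr (G (e k))"
      "\<And>k. r k \<in> G (Suc (e k))" by metis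
    obtain k l where kl: "k < l" "right_divisible (lm (r l)) (lm (r k))"
      using dickson_monomials[of "\<lambda>k. lm (r k)"] lm_in_monomials[OF r(1)] by blast
    have "Suc (e k) \<le> e l" using enumerate_mono[OF kl(1) inf] unfolding e_def by simp
    then have "r k \<in> G (e l)" using mono_G r(3) by blast
    then show False using r(2)[of l] kl(2) by (auto simp: Irr_def right_divisible_def)
  qed
  then obtain N where N: "\<And>i. i \<in> ?J \<Longrightarrow> i < N" using finite_nat_bounded[of ?J] by blast
  have "P (Suc i) \<subset> P i" if "i \<ge> N" for i
  proof -
    have "G (Suc i) = G i" using N[of i] that by (simp add: linorder_not_less[symmetric]) blast
    then show ?thesis using alt[of i] by auto
  qed
  moreover have "finite (P i)" for i
    using inv[of i] by (auto simp: gs_invariant_def P_def split: prod.splits)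
  ultimately have "card (P (Suc i)) < card (P i)" if "i \<ge> N" for i
    using that by (simp add: psubset_card_mono)
  then have less: "card (P (N + Suc i)) < card (P (N + i))" for i by simp
  have "card (P (N + i)) + i \<le> card (P N)" for i
  proof (induction i)
    case (Suc i)
    then show ?case using less[of i] by simp
  qed simp
  from this[of "Suc (card (P N))"] show False by simp
qed

end

section \<open>Correctness and termination\<close>

theorem theorem3p18:
  fixes scale :: "'k::field_char_0 \<Rightarrow> 'a::ring_1 \<Rightarrow> 'a"
    and R I :: "'a set" and m n l :: nat
    and S D f :: "nat \<Rightarrow> 'a"
    and \<sigma> \<delta> :: "nat \<Rightarrow> 'a \<Rightarrow> 'a"
    and gt :: "'a \<Rightarrow> 'a \<Rightarrow> bool"
  defines "step \<equiv> dd_algebra_order.gs_step R m n S D gt"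
    and "init \<equiv> dd_algebra_order.gs_init (f ` {..<l})"
  assumes "dd_algebra scale R m n S D \<sigma> \<delta>"
    and "k_algebra.finite_field_extension scale R"
    and "dd_algebra_order.dd_monomial_ordering R m n S D gt"
    and "\<And>i. i < l \<Longrightarrow> f i \<noteq> 0"
    and "I = generated_left_ideal (f ` {..<l})"
  shows "(\<forall>G P p q. step\<^sup>*\<^sup>* init (G, P) \<and> {p, q} \<in> P \<longrightarrow>
            (\<exists>r. dd_algebra_order.remainder R m n S D gt G
                   (dd_algebra_order.Spoly R m n S D gt p q) r))
       \<and> \<not> (\<exists>s. s 0 = init \<and> (\<forall>i. step (s i) (s (Suc i))))
       \<and> (\<forall>G. step\<^sup>*\<^sup>* init (G, {}) \<longrightarrow>
            finite G \<and> dd_algebra_order.left_GS_basis R m n S D gt I G)"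
proof -
  interpret A: dd_algebra scale R m n S D \<sigma> \<delta> by fact
  have field: "A.finite_field_extension R" by fact
  \<comment> \<open>By characteristic zero and finiteness of the extension, the derivations vanish.\<close>
  interpret A: dd_algebra_field scale R m n S D \<sigma> \<delta>
  proof
    show "x * y = y * x" if "x \<in> R" "y \<in> R" for x y
      using field that unfolding A.finite_field_extension_def by blast
    show "\<exists>y\<in>R. x * y = 1" if "x \<in> R" "x \<noteq> 0" for x
      using field that unfolding A.finite_field_extension_def by blast
    show "D i * r = r * D i" if "i < n" "r \<in> R" for i r
      using A.derivation_zero_on_finite_extension[OF _ field A.derivation_\<delta>[OF that(1)] that(2)]
        A.D_coeff[OF that] by simp
  qed
  interpret A: dd_algebra_order scale R m n S D \<sigma> \<delta> gt ..
  interpret A: dd_algebra_field_order scale R m n S D \<sigma> \<delta> gt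
    by unfold_locales fact
  let ?F = "f ` {..<l}"
  have F: "finite ?F" "0 \<notin> ?F" using assms(6) by auto
  have "\<exists>r. A.remainder G (A.Spoly p q) r" if "step\<^sup>*\<^sup>* init (G, P)" for G P p q
    using A.gs_invariant_reachable[OF F] that unfolding step_def init_def
    by (intro A.ex_remainder) (auto simp: A.gs_invariant_def)
  moreover have "\<not> (\<exists>s. s 0 = init \<and> (\<forall>i. step (s i) (s (Suc i))))"
    unfolding step_def init_def by (rule A.gs_terminates[OF F])
  moreover have "finite G \<and> A.left_GS_basis I G" if "step\<^sup>*\<^sup>* init (G, {})" for G
    using A.gs_result_is_basis[OF F] that unfolding step_def init_def assms(7) by blast
  ultimately show ?thesis by blast
qed

end
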